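(* Suppose there exist constants $a_8,a_9>0$ and $R_3>0$ such that $$\frac{\nu(r)}{\nu(R)}\ge a_8\Big(\frac Rr\Big)^{-a_9}\quad\text{for all }0<r\le R<R_3.$$ Then for every $N>0$, $$\lim_{t\to\infty}p(t,x)\sqrt{t(-\phi''(\sigma))}\,\exp\big(tH(\sigma)\big)=(2\pi)^{-1/2}\quad\text{uniformly in }x\in(0,N],$$ where $\sigma=(\phi')^{-1}(x/t)$. If in addition $T_0=0$, then for every $N>0$, $$\lim_{x\to0}p(t,x)\sqrt{t(-\phi''(\sigma))}\,\exp\big(tH(\sigma)\big)=(2\pi)^{-1/2}\quad\text{uniformly in }t\in[N,\infty).$$
   Context: $S=(S_t)_{t\ge0}$ is a subordinator (non-decreasing Lévy process on $\mathbb R$ with $S_0=0$) without drift. Its Laplace exponent $\phi$ is given by $\mathbb E e^{-\lambda S_t}=e^{-t\phi(\lambda)}$ and $\phi(\lambda)=\int_0^\infty(1-e^{-\lambda s})\nu(s)\,ds$, where the Lévy measure has a density $\nu:(0,\infty)\to[0,\infty)$ with $\int_0^\infty\min\{1,s\}\nu(s)ds<\infty$. (Inequalities on quotients of $\nu$ presuppose $\nu>0$ on the stated range.) Standing assumption: there is $T_0\in[0,\infty)$ with $\liminf_{x\to0}x\nu(x)=1/T_0$, where $1/0=\infty$. For $t>T_0$, $S_t$ has a transition density $p(t,\cdot)$, continuous and bounded on $(0,\infty)$. Notation: $H(\lambda)=\phi(\lambda)-\lambda\phi'(\lambda)$; $\phi'(0)=\lim_{\lambda\downarrow0}\phi'(\lambda)\in(0,\infty]$;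 $\sigma=\sigma(t,x)=(\phi')^{-1}(x/t)$ is defined for $t>0$, $0<x<t\phi'(0)$ (which holds for all large $t$, respectively all small $x$, in the limits considered). *)

theory Defs
  imports "HOL-Probability.Probability"
begin

locale levy_process = prob_space M for M :: "'a measure" +
  fixes X :: "real \<Rightarrow> 'a \<Rightarrow> real"
  assumes random_variable: "\<And>t. 0 \<le> t \<Longrightarrow> X t \<in> borel_measurable M"
    and start_zero: "AE \<omega> in M. X 0 \<omega> = 0"
    and independent_increments:
      "\<And>(n::nat) (t::nat \<Rightarrow> real). 0 \<le> t 0 \<Longrightarrow> (\<And>i. i < n \<Longrightarrow> t i < t (Suc i)) \<Longrightarrow>
         indep_vars (\<lambda>_. borel) (\<lambda>i \<omega>. X (t (Suc i)) \<omega> - X (t i) \<omega>) {..<n}"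
    and stationary_increments:
      "\<And>s t. 0 \<le> s \<Longrightarrow> 0 \<le> t \<Longrightarrow>
         distr M borel (\<lambda>\<omega>. X (s + t) \<omega> - X s \<omega>) = distr M borel (\<lambda>\<omega>. X t \<omega> - X 0 \<omega>)"
    and stochastically_continuous:
      "\<And>t \<epsilon>. 0 \<le> t \<Longrightarrow> 0 < \<epsilon> \<Longrightarrow>
         ((\<lambda>s. prob {\<omega> \<in> space M. \<epsilon> < \<bar>X s \<omega> - X t \<omega>\<bar>}) \<longlongrightarrow> 0) (at t within {0..})"
    and cadlag:
      "AE \<omega> in M. (\<forall>t\<ge>0. ((\<lambda>s. X s \<omega>) \<longlongrightarrow> X t \<omega>) (at_right t)) \<and>
                  (\<forall>t>0. \<exists>l. ((\<lambda>s. X s \<omega>) \<longlongrightarrow> l) (at_left t))"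

locale subordinator = levy_process M S for M :: "'a measure" and S +
  assumes nondecreasing: "AE \<omega> in M. mono_on {0..} (\<lambda>t. S t \<omega>)"

text \<open>
  A density on \<open>(0,\<infinity>)\<close> of a Levy measure of a subordinator. Values of \<open>\<nu>\<close> outside
  \<open>(0,\<infinity>)\<close> are irrelevant here and below.
\<close>

definition levy_density :: "(real \<Rightarrow> real) \<Rightarrow> bool" where
  "levy_density \<nu> \<longleftrightarrow>
     set_borel_measurable borel {0<..} \<nu> \<and> (\<forall>s>0. 0 \<le> \<nu> s) \<and>
     set_integrable lborel {0<..} (\<lambda>s. min 1 s * \<nu> s)"

definition laplace_exponent :: "(real \<Rightarrow> real) \<Rightarrow> real \<Rightarrow> real" where
  "laplace_exponent \<nu> u = (LBINT s:{0<..}. (1 - exp (- u * s)) * \<nu> s)"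

text \<open>
  The exponent above has no linear term, so this says that \<open>S\<close> has no drift and that its Levy
  measure has density \<open>\<nu>\<close>.
\<close>

definition driftless_subordinator_with_density ::
  "'a measure \<Rightarrow> (real \<Rightarrow> 'a \<Rightarrow> real) \<Rightarrow> (real \<Rightarrow> real) \<Rightarrow> bool" where
  "driftless_subordinator_with_density M S \<nu> \<longleftrightarrow>
     subordinator M S \<and> levy_density \<nu> \<and>
     (\<forall>t\<ge>0. \<forall>u\<ge>0. (\<integral>\<omega>. exp (- u * S t \<omega>) \<partial>M) = exp (- t * laplace_exponent \<nu> u))"

text \<open>
  Continuity determines \<open>f\<close> on \<open>(0,\<infinity>)\<close> uniquely; the indicator makes the values of \<open>f\<close>
  elsewhere irrelevant.
\<close>

definition bounded_continuous_density :: "'a measure \<Rightarrow> ('a \<Rightarrow> real) \<Rightarrow> (real \<Rightarrow> real) \<Rightarrow> bool" where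
  "bounded_continuous_density M X f \<longleftrightarrow>
     (\<forall>x>0. 0 \<le> f x) \<and> continuous_on {0<..} f \<and> bounded (f ` {0<..}) \<and>
     distributed M lborel X (\<lambda>x. ennreal (indicator {0<..} x * f x))"

definition H_fun :: "(real \<Rightarrow> real) \<Rightarrow> real \<Rightarrow> real" where
  "H_fun \<phi> u = \<phi> u - u * deriv \<phi> u"

text \<open>
  The derivative of a Laplace exponent maps \<open>(0,\<infinity>)\<close> bijectively onto \<open>(0,\<phi>'(0))\<close> (if the
  exponent is not identically zero), so \<open>\<sigma>\<close> is meaningful exactly when
  \<open>0 < x < t \<phi>'(0)\<close>; elsewhere it is an unspecified value.
\<close>

definition sigma_fun :: "(real \<Rightarrow> real) \<Rightarrow> real \<Rightarrow> real \<Rightarrow> real" where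
  "sigma_fun \<phi> t x = inv_into {0<..} (deriv \<phi>) (x / t)"

definition normalized_density ::
  "(real \<Rightarrow> real \<Rightarrow> real) \<Rightarrow> (real \<Rightarrow> real) \<Rightarrow> real \<Rightarrow> real \<Rightarrow> real" where
  "normalized_density p \<phi> t x =
     (let \<sigma> = sigma_fun \<phi> t x
      in p t x * sqrt (t * (- deriv (deriv \<phi>) \<sigma>)) * exp (t * H_fun \<phi> \<sigma>))"

end

theory Submission
  imports Defs "HOL-Complex_Analysis.Conformal_Mappings" "HOL-Real_Asymp.Real_Asymp"
begin

text \<open>
  Tilting the law of \<open>S t\<close> by \<open>exp (- \<sigma> y)\<close> moves its mean to \<open>x\<close>, so Fourier inversion of the tilted
  density at its mean shows that, after rescaling by the standard deviation \<open>sqrt V\<close> with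
  \<open>V = - t \<phi>''(\<sigma>)\<close>, the normalized density is \<open>1 / (2 \<pi>)\<close> times the integral of
  \<open>exp (t \<Psi> (\<theta> / sqrt V))\<close>, where \<open>\<Psi> \<xi>\<close> is the integral of \<open>(exp (\<i> \<xi> s) - 1 - \<i> \<xi> s) exp (- \<sigma> s) \<nu> s\<close>.
  The scaling hypothesis gives \<open>\<nu> (l s) \<ge> \<kappa> \<nu> s\<close> for \<open>1/2 \<le> l \<le> 1\<close> and small \<open>s\<close>. By substitution, moments
  at \<open>\<sigma>\<close> and \<open>\<sigma> / 2\<close> are comparable; by averaging over \<open>l\<close>, the oscillating factor \<open>1 - cos (\<xi> s)\<close> in
  \<open>- Re \<Psi>\<close> may be replaced by \<open>min 1 ((\<xi> s)\<^sup>2)\<close>. With \<open>w = \<sigma>\<^sup>2 V\<close> this bounds the difference between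
  \<open>exp (t \<Psi> (\<theta> / sqrt V))\<close> and \<open>exp (- \<theta>\<^sup>2 / 2)\<close> by a constant times \<open>1 / (sqrt w (1 + \<theta>\<^sup>2))\<close>: for
  \<open>\<theta>\<^sup>2 \<le> w\<close> by a third order Taylor expansion, for \<open>\<theta>\<^sup>2 > w\<close> by the logarithmic growth of \<open>- Re \<Psi>\<close> that comes
  from a lower bound \<open>s \<nu> s \<ge> m\<close> near \<open>0\<close>. Only \<open>t m\<close> has to be large, and then so is \<open>w\<close>; this is achieved by
  \<open>t \<rightarrow> \<infinity>\<close> in the first claim and by \<open>m \<rightarrow> \<infinity>\<close> in the second.
\<close>

section \<open>Integrals depending on a parameter, and Fourier inversion\<close>

text \<open>On the convex ball the mean value inequality bounds all difference quotients by
  \<open>B\<close>, so dominated convergence applies along every sequence tending to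
  \<open>z0\<close>. The general normed field covers both the real derivatives of the exponent and
  its holomorphy.\<close>

lemma has_field_derivative_integral:
  fixes f f' :: "'b::{real_normed_field, banach, second_countable_topology} \<Rightarrow> 'a \<Rightarrow> 'b"
  assumes r: "0 < r"
    and int: "\<And>z. z \<in> ball z0 r \<Longrightarrow> integrable M (f z)"
    and meas: "f' z0 \<in> borel_measurable M"
    and B: "integrable M B"
    and der: "AE s in M. \<forall>z\<in>ball z0 r. ((\<lambda>z. f z s) has_field_derivative f' z s) (at z) \<and> norm (f' z s) \<le> B s"
  shows "((\<lambda>z. \<integral>s. f z s \<partial>M) has_field_derivative (\<integral>s. f' z0 s \<partial>M)) (at z0)"
proof -
  let ?S = "ball z0 r" and ?F = "\<lambda>z. \<integral>s. f z s \<partial>M"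
  have z0: "z0 \<in> ?S" using r by simp
  have "((\<lambda>y. (?F y - ?F z0) / (y - z0)) \<longlongrightarrow> (\<integral>s. f' z0 s \<partial>M)) (at z0 within ?S)"
    unfolding tendsto_at_iff_sequentially
  proof (intro allI impI)
    fix X assume X: "\<forall>i. X i \<in> ?S - {z0}" "X \<longlonglongrightarrow> z0"
    have "(\<lambda>i. \<integral>s. (f (X i) s - f z0 s) / (X i - z0) \<partial>M) \<longlonglongrightarrow> (\<integral>s. f' z0 s \<partial>M)"
    proof (rule integral_dominated_convergence[where w = B])
      show "AE s in M. (\<lambda>i. (f (X i) s - f z0 s) / (X i - z0)) \<longlonglongrightarrow> f' z0 s"
        using der
      proof eventually_elim
        case (elim s)
        then have "((\<lambda>z. f z s) has_field_derivative f' z0 s) (at z0)" using z0 by blast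
        then have "((\<lambda>y. (f y s - f z0 s) / (y - z0)) \<longlongrightarrow> f' z0 s) (at z0)"
          by (simp add: has_field_derivative_iff)
        moreover have "filterlim X (at z0) sequentially"
          using X by (auto simp: filterlim_at)
        ultimately show ?case by (rule filterlim_compose)
      qed
      show "AE s in M. norm ((f (X i) s - f z0 s) / (X i - z0)) \<le> B s" for i
        using der
      proof eventually_elim
        case (elim s)
        have "norm (f (X i) s - f z0 s) \<le> B s * norm (X i - z0)"
          by (rule field_differentiable_bound[of ?S "\<lambda>z. f z s" "\<lambda>z. f' z s"])
            (use elim X z0 in \<open>auto intro: has_field_derivative_at_within\<close>)
        moreover have "X i \<noteq> z0" using X by auto
        ultimately show ?case by (simp add: norm_divide field_simps)
      qed
      show "(\<lambda>s. (f (X i) s - f z0 s) / (X i - z0)) \<in> borel_measurable M" for i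
        using int[of "X i"] int[OF z0] X by auto
    qed (use meas B in auto)
    moreover have "(\<integral>s. (f (X i) s - f z0 s) / (X i - z0) \<partial>M) = (?F (X i) - ?F z0) / (X i - z0)" for i
      using int[of "X i"] int[OF z0] X by (subst integral_divide_zero) simp
    ultimately show "((\<lambda>y. (?F y - ?F z0) / (y - z0)) \<circ> X) \<longlonglongrightarrow> (\<integral>s. f' z0 s \<partial>M)"
      by (simp only: comp_def)
  qed
  then show ?thesis
    using at_within_open[OF z0] by (simp add: has_field_derivative_iff)
qed

text \<open>Mean value inequality on the convex half-plane \<open>Re z \<le> m\<close>, where the
  derivative of \<open>exp\<close> has norm at most \<open>exp m\<close>.\<close>

lemma norm_exp_diff_le:
  fixes a b :: complex
  assumes "Re a \<le> m" "Re b \<le> m"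
  shows "norm (exp a - exp b) \<le> exp m * norm (a - b)"
  by (rule field_differentiable_bound[of "{z. Re z \<le> m}" exp exp])
    (use assms in \<open>auto intro: DERIV_exp[THEN DERIV_subset] convex_halfspace_Re_le\<close>)

text \<open>The mean value bound \<open>norm z * s\<close> serves for small \<open>s\<close>, the
  trivial bound 2 for large \<open>s\<close>. Together they give a multiple of
  \<open>min 1 s\<close>, the only function assumed integrable against a Levy measure.\<close>

lemma norm_one_minus_exp_le:
  fixes z :: complex
  assumes "0 \<le> Re z" "0 \<le> s"
  shows "norm (1 - exp (- (z * of_real s))) \<le> (2 + norm z) * min 1 s"
proof -
  have re: "Re (- (z * of_real s)) \<le> 0" using assms by simp
  have "norm (1 - exp (- (z * of_real s))) \<le> norm z * s"
    using norm_exp_diff_le[of 0 0 "- (z * of_real s)"] re assms by (simp add: norm_mult)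
  moreover have "norm (1 - exp (- (z * of_real s))) \<le> 1 + 1"
    by (rule order_trans[OF norm_triangle_ineq4]) (use re in auto)
  moreover have "0 \<le> norm z" by simp
  ultimately have "norm (1 - exp (- (z * of_real s))) \<le> (2 + norm z) * s"
      "norm (1 - exp (- (z * of_real s))) \<le> 2 + norm z"
    using assms by (simp_all only: distrib_right)
  then show ?thesis by (simp add: min_def)
qed

lemma power_div_fact_le_exp:
  fixes x :: real
  assumes "0 \<le> x"
  shows "x ^ n / fact n \<le> exp x"
proof -
  have "(\<Sum>k\<in>{n}. x ^ k /\<^sub>R fact k) \<le> (\<Sum>k. x ^ k /\<^sub>R fact k)"
    by (rule sum_le_suminf) (use assms sums_summable[OF exp_converges[of x]] in auto)
  then show ?thesis
    using sums_unique[OF exp_converges[of x]] by (simp add: divide_inverse mult.commute)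
qed

text \<open>For \<open>s \<le> 1\<close> the power is at most \<open>s\<close>; for larger
  \<open>s\<close> a single term of the exponential series of \<open>u * s\<close> beats it.\<close>

lemma power_times_exp_le:
  fixes u s :: real
  assumes "0 < u" "0 \<le> s" "1 \<le> n"
  shows "s ^ n * exp (- u * s) \<le> (1 + fact n / u ^ n) * min 1 s"
proof (cases "s \<le> 1")
  case True
  have "s ^ n \<le> s ^ 1" using assms True by (intro power_decreasing) auto
  moreover have "exp (- u * s) \<le> 1" using assms by simp
  ultimately have "s ^ n * exp (- u * s) \<le> s * 1" by (intro mult_mono) (use assms in auto)
  also have "\<dots> \<le> (1 + fact n / u ^ n) * s"
    using assms by (simp add: algebra_simps)
  finally show ?thesis using True by simp
next
  case False
  have "(u * s) ^ n / fact n \<le> exp (u * s)"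
    by (rule power_div_fact_le_exp) (use assms in auto)
  then have "s ^ n * exp (- u * s) \<le> fact n / u ^ n"
    using assms by (simp add: field_simps power_mult_distrib exp_minus)
  then show ?thesis using False by simp
qed

section \<open>Fourier inversion at a point of continuity\<close>

text \<open>Levy's inversion formula gives the mass of the interval from \<open>x\<close> to
  \<open>x + h\<close>. Integrability of the characteristic function turns the principal value into
  a Lebesgue integral; dividing by \<open>h\<close> and letting \<open>h\<close> tend to 0 gives the
  density. Continuity is asked only at \<open>x\<close> because the density to which this is applied
  may jump at 0.\<close>

lemma fourier_inversion:
  fixes q :: "real \<Rightarrow> real"
  defines "Q \<equiv> density lborel (\<lambda>y. ennreal (q y))"
  assumes meas [measurable]: "q \<in> borel_measurable borel" and nonneg: "\<And>y. 0 \<le> q y"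
    and prob: "prob_space Q"
    and int: "integrable lborel (char Q)"
    and cont: "isCont q x"
  shows "complex_of_real (q x) = 1 / (2 * pi) * (\<integral>\<xi>. iexp (- (\<xi> * x)) * char Q \<xi> \<partial>lborel)"
proof -
  interpret prob_space Q by fact
  interpret real_distribution Q
    by unfold_locales (simp_all add: Q_def)
  have int_q: "integrable lborel q"
  proof (rule integrableI_nonneg)
    have "emeasure Q (space Q) = (\<integral>\<^sup>+y. ennreal (q y) \<partial>lborel)"
      by (simp add: Q_def emeasure_density)
    then show "(\<integral>\<^sup>+y. ennreal (q y) \<partial>lborel) < \<infinity>"
      using emeasure_space_1 by simp
  qed (use nonneg in auto)
  have measure_Q: "measure Q A = (\<integral>y. q y * indicator A y \<partial>lborel)" if [measurable]: "A \<in> sets borel" for A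
  proof -
    have "measure Q A = (\<integral>y. indicator A y \<partial>Q)"
      by (simp add: Q_def)
    also have "\<dots> = (\<integral>y. q y * indicator A y \<partial>lborel)"
      unfolding Q_def by (subst integral_density) (use nonneg in auto)
    finally show ?thesis .
  qed
  have null: "measure Q {a} = 0" for a
  proof -
    have "(\<integral>y. q y * indicator {a} y \<partial>lborel) = (\<integral>y. 0 \<partial>(lborel :: real measure))"
      by (intro integral_cong_AE) (use AE_lborel_singleton[of a] in auto)
    then show ?thesis by (simp add: measure_Q)
  qed
  \<comment> \<open>The kernel of Levy's formula. At frequency 0 division by zero makes it 0, which
    matters only on a null set.\<close>
  define G where "G h \<xi> = (iexp (- (\<xi> * x)) - iexp (- (\<xi> * (x + h)))) / (\<i> * \<xi>) * char Q \<xi>" for h \<xi>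
  have G_meas [measurable]: "G h \<in> borel_measurable borel" for h
    unfolding G_def by measurable
  have G_bound: "norm (G h \<xi>) \<le> h * norm (char Q \<xi>)" if "0 \<le> h" for h \<xi>
  proof (cases "\<xi> = 0")
    case False
    then have "norm ((iexp (\<xi> * - x) - iexp (\<xi> * - (x + h))) / (\<i> * \<xi>)) \<le> - x - (- (x + h))"
      by (intro Levy_Inversion_aux2) (use that in auto)
    moreover have "\<xi> * - x = - (\<xi> * x)" "\<xi> * - (x + h) = - (\<xi> * (x + h))"
      by (simp_all add: algebra_simps)
    ultimately show ?thesis unfolding G_def norm_mult by (intro mult_right_mono) (simp_all only:, simp_all)
  qed (use that in \<open>simp add: G_def\<close>)
  have step1: "of_real (measure Q {x<..x + h}) = 1 / (2 * pi) * (\<integral>\<xi>. G h \<xi> \<partial>lborel)" if h: "0 < h" for h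
  proof (rule LIMSEQ_unique)
    show "(\<lambda>T. 1 / (2 * pi) * (CLBINT t=ereal (- real T)..ereal (real T). G h t)) \<longlonglongrightarrow> of_real (measure Q {x<..x + h})"
      using Levy_Inversion[of x "x + h"] h null unfolding G_def by simp
    have "(\<lambda>T. (\<integral>t. indicator {- real T<..<real T} t *\<^sub>R G h t \<partial>lborel)) \<longlonglongrightarrow> (\<integral>\<xi>. G h \<xi> \<partial>lborel)"
    proof (rule integral_dominated_convergence[where w = "\<lambda>\<xi>. h * norm (char Q \<xi>)"])
      show "integrable lborel (\<lambda>\<xi>. h * norm (char Q \<xi>))" using int by simp
      show "AE t in lborel. (\<lambda>T. indicator {- real T<..<real T} t *\<^sub>R G h t) \<longlonglongrightarrow> G h t"
      proof (rule AE_I2)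
        fix t :: real
        have "eventually (\<lambda>T. indicator {- real T<..<real T} t *\<^sub>R G h t = G h t) sequentially"
          using eventually_gt_at_top[of "nat \<lceil>\<bar>t\<bar>\<rceil>"]
        proof eventually_elim
          case (elim T)
          then have "\<bar>t\<bar> < real T" by linarith
          then show ?case by (simp add: indicator_def abs_less_iff)
        qed
        then show "(\<lambda>T. indicator {- real T<..<real T} t *\<^sub>R G h t) \<longlonglongrightarrow> G h t"
          by (rule tendsto_eventually)
      qed
      show "AE t in lborel. norm (indicator {- real T<..<real T} t *\<^sub>R G h t) \<le> h * norm (char Q t)" for T
        using G_bound[of h] h by (intro AE_I2) (auto simp: indicator_def)
    qed auto
    then have "(\<lambda>T. (CLBINT t=ereal (- real T)..ereal (real T). G h t)) \<longlonglongrightarrow> (\<integral>\<xi>. G h \<xi> \<partial>lborel)"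
      by (simp add: interval_lebesgue_integral_def set_lebesgue_integral_def)
    then show "(\<lambda>T. 1 / (2 * pi) * (CLBINT t=ereal (- real T)..ereal (real T). G h t)) \<longlonglongrightarrow> 1 / (2 * pi) * (\<integral>\<xi>. G h \<xi> \<partial>lborel)"
      by (rule tendsto_mult_left)
  qed
  define h where "h n = 1 / real (Suc n)" for n
  have h_pos: "0 < h n" for n by (simp add: h_def)
  have h_lim: "h \<longlonglongrightarrow> 0" unfolding h_def by (rule lim_1_over_n[THEN LIMSEQ_Suc])
  have lim_Fourier: "(\<lambda>n. \<integral>\<xi>. G (h n) \<xi> / h n \<partial>lborel) \<longlonglongrightarrow> (\<integral>\<xi>. iexp (- (\<xi> * x)) * char Q \<xi> \<partial>lborel)"
  proof (rule integral_dominated_convergence[where w = "\<lambda>\<xi>. norm (char Q \<xi>)"])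
    show "AE \<xi> in lborel. (\<lambda>n. G (h n) \<xi> / h n) \<longlonglongrightarrow> iexp (- (\<xi> * x)) * char Q \<xi>"
      using AE_lborel_singleton[of 0]
    proof eventually_elim
      fix \<xi> :: real assume \<xi>: "\<xi> \<noteq> 0"
      \<comment> \<open>The derivative of \<open>?g\<close> at 0 is the Fourier kernel, and
        \<open>G (h n) \<xi> / h n\<close> is its difference quotient at step \<open>h n\<close>
        times the characteristic function.\<close>
      let ?g = "\<lambda>z :: complex. - exp (- (\<i> * of_real \<xi> * (of_real x + z))) / (\<i> * of_real \<xi>)"
      have "(?g has_field_derivative iexp (- (\<xi> * x))) (at 0)"
        using \<xi> by (auto intro!: derivative_eq_intros simp: field_simps)
      then have "((\<lambda>z. (?g z - ?g 0) / (z - 0)) \<longlongrightarrow> iexp (- (\<xi> * x))) (at 0)"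
        by (simp add: has_field_derivative_iff)
      moreover have "filterlim (\<lambda>n. complex_of_real (h n)) (at 0) sequentially"
        using h_lim h_pos by (auto simp: filterlim_at tendsto_of_real_iff[where c = 0, simplified] less_imp_neq[THEN not_sym])
      ultimately have "(\<lambda>n. (?g (h n) - ?g 0) / (of_real (h n) - 0)) \<longlonglongrightarrow> iexp (- (\<xi> * x))"
        by (rule filterlim_compose)
      then have "(\<lambda>n. (?g (h n) - ?g 0) / (of_real (h n) - 0) * char Q \<xi>) \<longlonglongrightarrow> iexp (- (\<xi> * x)) * char Q \<xi>"
        by (rule tendsto_mult_right)
      moreover have "(?g (h n) - ?g 0) / (of_real (h n) - 0) * char Q \<xi> = G (h n) \<xi> / h n" for n
        using \<xi> h_pos[of n] by (simp add: G_def field_simps)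
      ultimately show "(\<lambda>n. G (h n) \<xi> / h n) \<longlonglongrightarrow> iexp (- (\<xi> * x)) * char Q \<xi>"
        by (simp only:)
    qed
    show "AE \<xi> in lborel. norm (G (h n) \<xi> / h n) \<le> norm (char Q \<xi>)" for n
      using G_bound[of "h n"] h_pos[of n] by (intro AE_I2) (simp add: norm_divide field_simps)
  qed (use int in auto)
  have lim_density: "(\<lambda>n. measure Q {x<..x + h n} / h n) \<longlonglongrightarrow> q x"
  proof (rule LIMSEQ_I)
    fix e :: real assume e: "0 < e"
    obtain d where d: "0 < d" "\<And>y. \<bar>y - x\<bar> < d \<Longrightarrow> \<bar>q y - q x\<bar> < e / 2"
      using cont e unfolding continuous_at_eps_delta dist_real_def by (metis half_gt_zero)
    obtain n0 where n0: "\<And>n. n \<ge> n0 \<Longrightarrow> h n < d"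
      using order_tendstoD(2)[OF h_lim d(1)] by (auto simp: eventually_sequentially)
    have "norm (measure Q {x<..x + h n} / h n - q x) < e" if n: "n \<ge> n0" for n
    proof -
      let ?A = "{x<..x + h n}"
      have near: "q x - e / 2 \<le> q y" "q y \<le> q x + e / 2" if "y \<in> ?A" for y
      proof -
        have "\<bar>q y - q x\<bar> < e / 2" using d(2)[of y] n0[OF n] that by auto
        then show "q x - e / 2 \<le> q y" "q y \<le> q x + e / 2" by linarith+
      qed
      have int_c: "integrable lborel (\<lambda>y. c * indicator ?A y)" for c :: real
        using h_pos[of n] by (intro integrable_mult_right integrable_real_indicator) auto
      have val_c: "(\<integral>y. c * indicator ?A y \<partial>lborel) = c * h n" for c :: real
        using h_pos[of n] by simp
      have int_qA: "integrable lborel (\<lambda>y. q y * indicator ?A y)"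
        by (intro integrable_real_mult_indicator int_q) auto
      have "(\<integral>y. (q x - e / 2) * indicator ?A y \<partial>lborel) \<le> (\<integral>y. q y * indicator ?A y \<partial>lborel)"
        by (rule integral_mono[OF int_c int_qA]) (use near in \<open>auto simp: indicator_def\<close>)
      moreover have "(\<integral>y. q y * indicator ?A y \<partial>lborel) \<le> (\<integral>y. (q x + e / 2) * indicator ?A y \<partial>lborel)"
        by (rule integral_mono[OF int_qA int_c]) (use near in \<open>auto simp: indicator_def\<close>)
      ultimately have "(q x - e / 2) * h n \<le> measure Q ?A" "measure Q ?A \<le> (q x + e / 2) * h n"
        unfolding val_c by (simp_all add: measure_Q)
      then have "q x - e / 2 \<le> measure Q ?A / h n" "measure Q ?A / h n \<le> q x + e / 2"
        using h_pos[of n] by (simp_all add: field_simps)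
      then show ?thesis using e by (simp add: abs_less_iff)
    qed
    then show "\<exists>no. \<forall>n\<ge>no. norm (measure Q {x<..x + h n} / h n - q x) < e" by blast
  qed
  have "(\<lambda>n. complex_of_real (measure Q {x<..x + h n} / h n)) \<longlonglongrightarrow> of_real (q x)"
    using lim_density by (rule tendsto_of_real)
  moreover have "complex_of_real (measure Q {x<..x + h n} / h n) = 1 / (2 * pi) * (\<integral>\<xi>. G (h n) \<xi> / h n \<partial>lborel)" for n
    unfolding of_real_divide step1[OF h_pos[of n]] by simp
  ultimately have "(\<lambda>n. 1 / (2 * pi) * (\<integral>\<xi>. G (h n) \<xi> / h n \<partial>lborel)) \<longlonglongrightarrow> of_real (q x)"
    by simp
  moreover have "(\<lambda>n. 1 / (2 * pi) * (\<integral>\<xi>. G (h n) \<xi> / h n \<partial>lborel)) \<longlonglongrightarrow>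
      1 / (2 * pi) * (\<integral>\<xi>. iexp (- (\<xi> * x)) * char Q \<xi> \<partial>lborel)"
    by (intro tendsto_mult_left lim_Fourier)
  ultimately show ?thesis by (rule LIMSEQ_unique)
qed

section \<open>Laplace exponents of Levy measures\<close>

text \<open>This is kept general enough to cover two cases: the Levy measure, possibly infinite near
  0, and the law of the subordinator at a fixed time, which is finite.\<close>

locale levy_like_measure =
  fixes N :: "real measure"
  assumes sets_N [measurable_cong, simp]: "sets N = sets borel"
    and AE_pos: "AE s in N. 0 < s"
    and integrable_min: "integrable N (\<lambda>s. min 1 s)"
begin

text \<open>With \<phi> the Laplace exponent, \<open>moment 1\<close> is its first derivative and
  \<open>moment 2\<close> the negative of its second.\<close>

definition moment :: "nat \<Rightarrow> real \<Rightarrow> real" where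
  "moment n u = (\<integral>s. s ^ n * exp (- u * s) \<partial>N)"

lemma integrable_le_min:
  fixes g :: "real \<Rightarrow> 'b::{banach, second_countable_topology}"
  assumes "g \<in> borel_measurable borel" "\<And>s. 0 < s \<Longrightarrow> norm (g s) \<le> C * min 1 s"
  shows "integrable N g"
proof (rule Bochner_Integration.integrable_bound)
  show "integrable N (\<lambda>s. C * min 1 s)" using integrable_min by simp
  show "g \<in> borel_measurable N" using assms(1) by measurable
  show "AE s in N. norm (g s) \<le> norm (C * min 1 s)"
    using AE_pos by eventually_elim (use assms(2) in \<open>force intro: order_trans[OF _ abs_ge_self]\<close>)
qed

lemma integrable_moment:
  assumes "0 < u" "1 \<le> n"
  shows "integrable N (\<lambda>s. s ^ n * exp (- u * s))"
proof (rule integrable_le_min)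
  show "norm (s ^ n * exp (- u * s)) \<le> (1 + fact n / u ^ n) * min 1 s" if "0 < s" for s
    using power_times_exp_le[of u s n] assms that by simp
qed simp

lemma integrable_laplace:
  fixes z :: complex
  assumes "0 \<le> Re z"
  shows "integrable N (\<lambda>s. 1 - exp (- (z * of_real s)))"
  by (rule integrable_le_min[where C = "2 + norm z"])
    (use norm_one_minus_exp_le[OF assms] in auto)

lemma integrable_laplace_real:
  assumes "0 \<le> u"
  shows "integrable N (\<lambda>s. 1 - exp (- u * s))"
proof -
  have "integrable N (\<lambda>s. Re (1 - exp (- (complex_of_real u * of_real s))))"
    by (rule integrable_Re[OF integrable_laplace]) (use assms in simp)
  then show ?thesis by (simp flip: of_real_mult of_real_minus add: exp_of_real)
qed

text \<open>On the ball of radius \<open>Re z / 2\<close> about \<open>z\<close> real parts stay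
  above \<open>Re z / 2\<close>, so the differentiated integrand is dominated by
  \<open>s * exp (- (Re z / 2) * s)\<close>.\<close>

lemma holomorphic_laplace:
  "(\<lambda>z. \<integral>s. 1 - exp (- (z * complex_of_real s)) \<partial>N) holomorphic_on {z. 0 < Re z}"
proof -
  have "((\<lambda>z. \<integral>s. 1 - exp (- (z * complex_of_real s)) \<partial>N) has_field_derivative
          (\<integral>s. of_real s * exp (- (z * of_real s)) \<partial>N)) (at z)" if "0 < Re z" for z
  proof (rule has_field_derivative_integral[where r = "Re z / 2" and B = "\<lambda>s. s ^ 1 * exp (- (Re z / 2) * s)"
        and f' = "\<lambda>z s. of_real s * exp (- (z * of_real s))"])
    have re: "Re z / 2 \<le> Re y" if "y \<in> ball z (Re z / 2)" for y
    proof -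
      have "Re z - Re y \<le> norm (z - y)" using complex_Re_le_cmod[of "z - y"] by simp
      then show ?thesis using that by (simp add: dist_norm)
    qed
    show "integrable N (\<lambda>s. 1 - exp (- (y * complex_of_real s)))" if "y \<in> ball z (Re z / 2)" for y
      by (rule integrable_laplace) (use re[OF that] \<open>0 < Re z\<close> in simp)
    show "AE s in N. \<forall>y\<in>ball z (Re z / 2).
        ((\<lambda>z. 1 - exp (- (z * of_real s))) has_field_derivative of_real s * exp (- (y * of_real s))) (at y) \<and>
        cmod (of_real s * exp (- (y * of_real s))) \<le> s ^ 1 * exp (- (Re z / 2) * s)"
      using AE_pos
    proof (eventually_elim, intro ballI conjI)
      fix s :: real and y assume s: "0 < s" and y: "y \<in> ball z (Re z / 2)"
      show "((\<lambda>z. 1 - exp (- (z * complex_of_real s))) has_field_derivative of_real s * exp (- (y * of_real s))) (at y)"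
        by (auto intro!: derivative_eq_intros)
      show "cmod (of_real s * exp (- (y * of_real s))) \<le> s ^ 1 * exp (- (Re z / 2) * s)"
        using s mult_right_mono[OF re[OF y], of s] by (simp add: norm_mult)
    qed
  qed (use that integrable_moment[of "Re z / 2" 1] in auto)
  then show ?thesis
    by (auto simp: holomorphic_on_def field_differentiable_def intro: has_field_derivative_at_within)
qed

text \<open>Domination as in the holomorphic case, now on the ball of radius \<open>u / 2\<close>.
  The order must be at least 1 because the measure may have infinite mass near 0.\<close>

lemma has_derivative_moment:
  assumes "0 < u" "1 \<le> n"
  shows "(moment n has_real_derivative - moment (Suc n) u) (at u)"
proof -
  have re: "u / 2 \<le> y" if "y \<in> ball u (u / 2)" for y
    using that unfolding mem_ball dist_real_def by arith
  have "((\<lambda>u. \<integral>s. s ^ n * exp (- u * s) \<partial>N) has_field_derivative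
          (\<integral>s. - (s ^ Suc n * exp (- u * s)) \<partial>N)) (at u)"
  proof (rule has_field_derivative_integral[where r = "u / 2" and B = "\<lambda>s. s ^ Suc n * exp (- (u / 2) * s)"
        and f' = "\<lambda>u s. - (s ^ Suc n * exp (- u * s))"])
    show "integrable N (\<lambda>s. s ^ n * exp (- y * s))" if "y \<in> ball u (u / 2)" for y
      using re[OF that] assms by (intro integrable_moment) auto
    show "AE s in N. \<forall>y\<in>ball u (u / 2).
        ((\<lambda>u. s ^ n * exp (- u * s)) has_field_derivative - (s ^ Suc n * exp (- y * s))) (at y) \<and>
        norm (- (s ^ Suc n * exp (- y * s))) \<le> s ^ Suc n * exp (- (u / 2) * s)"
      using AE_pos
    proof (eventually_elim, intro ballI conjI)
      fix s :: real and y assume s: "0 < s" and y: "y \<in> ball u (u / 2)"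
      show "((\<lambda>u. s ^ n * exp (- u * s)) has_field_derivative - (s ^ Suc n * exp (- y * s))) (at y)"
        by (auto intro!: derivative_eq_intros)
      show "norm (- (s ^ Suc n * exp (- y * s))) \<le> s ^ Suc n * exp (- (u / 2) * s)"
        using s mult_right_mono[OF re[OF y], of s] by (simp add: abs_mult)
    qed
  qed (use assms integrable_moment[of "u / 2" "Suc n"] in auto)
  then show ?thesis by (simp add: moment_def[abs_def])
qed

lemma has_derivative_laplace:
  assumes "0 < u"
  shows "((\<lambda>u. \<integral>s. 1 - exp (- u * s) \<partial>N) has_real_derivative moment 1 u) (at u)"
proof -
  have re: "u / 2 \<le> y" if "y \<in> ball u (u / 2)" for y
    using that unfolding mem_ball dist_real_def by arith
  have "((\<lambda>u. \<integral>s. 1 - exp (- u * s) \<partial>N) has_field_derivative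
          (\<integral>s. s ^ 1 * exp (- u * s) \<partial>N)) (at u)"
  proof (rule has_field_derivative_integral[where r = "u / 2" and B = "\<lambda>s. s ^ 1 * exp (- (u / 2) * s)"
        and f' = "\<lambda>u s. s ^ 1 * exp (- u * s)"])
    show "integrable N (\<lambda>s. 1 - exp (- y * s))" if "y \<in> ball u (u / 2)" for y
      using re[OF that] assms by (intro integrable_laplace_real) auto
    show "AE s in N. \<forall>y\<in>ball u (u / 2).
        ((\<lambda>u. 1 - exp (- u * s)) has_field_derivative s ^ 1 * exp (- y * s)) (at y) \<and>
        norm (s ^ 1 * exp (- y * s)) \<le> s ^ 1 * exp (- (u / 2) * s)"
      using AE_pos
    proof (eventually_elim, intro ballI conjI)
      fix s :: real and y assume s: "0 < s" and y: "y \<in> ball u (u / 2)"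
      show "((\<lambda>u. 1 - exp (- u * s)) has_field_derivative s ^ 1 * exp (- y * s)) (at y)"
        by (auto intro!: derivative_eq_intros)
      show "norm (s ^ 1 * exp (- y * s)) \<le> s ^ 1 * exp (- (u / 2) * s)"
        using s mult_right_mono[OF re[OF y], of s] by (simp add: abs_mult)
    qed
  qed (use assms integrable_moment[of "u / 2" 1] in auto)
  then show ?thesis by (simp add: moment_def[abs_def])
qed

section \<open>From real to complex Laplace transforms\<close>

text \<open>Both sides are holomorphic in the right half-plane and agree on the positive reals, so
  the identity theorem applies. The measure \<open>P\<close> is itself an instance of the locale,
  which yields holomorphy of its transform without a separate argument.\<close>

lemma laplace_transform_eqI:
  fixes P :: "real measure"
  assumes P: "finite_measure P" "sets P = sets borel" "AE y in P. 0 < y"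
    and eq: "\<And>u. 0 < u \<Longrightarrow> (\<integral>y. exp (- u * y) \<partial>P) = exp (- t * (\<integral>s. 1 - exp (- u * s) \<partial>N))"
    and z: "0 < Re z"
  shows "(\<integral>y. exp (- (z * complex_of_real y)) \<partial>P) = exp (- of_real t * (\<integral>s. 1 - exp (- (z * complex_of_real s)) \<partial>N))"
proof -
  interpret P: finite_measure P by fact
  have [measurable_cong]: "sets P = sets borel" by fact
  interpret P: levy_like_measure P
    using P by unfold_locales (auto intro!: P.integrable_const_bound[where B = 1])
  \<comment> \<open>Writing the transform as total mass minus the integral of \<open>1 - exp\<close>
    brings it into the form whose holomorphy is known.\<close>
  define L where "L z = of_real (measure P (space P)) - (\<integral>y. 1 - exp (- (z * complex_of_real y)) \<partial>P)" for z
  define E where "E z = exp (- of_real t * (\<integral>s. 1 - exp (- (z * complex_of_real s)) \<partial>N))" for z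
  have L_eq: "L z = (\<integral>y. exp (- (z * complex_of_real y)) \<partial>P)" if "0 < Re z" for z
  proof -
    have "(\<integral>y. exp (- (z * complex_of_real y)) \<partial>P) = (\<integral>y. 1 - (1 - exp (- (z * complex_of_real y))) \<partial>P)"
      by simp
    also have "\<dots> = L z"
      unfolding L_def using P.integrable_laplace[of z] that
      by (subst Bochner_Integration.integral_diff) (auto simp: scaleR_conv_of_real)
    finally show ?thesis by simp
  qed
  have hol: "(\<lambda>z. L z - E z) holomorphic_on {z. 0 < Re z}"
    unfolding L_def E_def by (intro holomorphic_intros holomorphic_laplace P.holomorphic_laplace)
  have zero: "L w - E w = 0" if "w \<in> of_real ` {0<..}" for w
  proof -
    from that obtain u where u: "w = of_real u" "0 < u" by auto
    have 1: "(\<integral>y. exp (- (w * complex_of_real y)) \<partial>P) = of_real (\<integral>y. exp (- u * y) \<partial>P)"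
      unfolding u(1) by (simp flip: integral_complex_of_real exp_of_real)
    have 2: "(\<integral>s. 1 - exp (- (w * complex_of_real s)) \<partial>N) = of_real (\<integral>s. 1 - exp (- u * s) \<partial>N)"
      unfolding u(1) by (simp flip: integral_complex_of_real exp_of_real)
    have "L w = exp (- of_real t * of_real (\<integral>s. 1 - exp (- u * s) \<partial>N))"
      using L_eq[of w] u eq[OF u(2)] unfolding 1 by (simp flip: exp_of_real)
    then show ?thesis by (simp add: E_def 2)
  qed
  have "L z - E z = 0"
  proof (rule analytic_continuation[OF hol, of "of_real ` {0<..}" 1 z])
    show "open {z. 0 < Re z}" by (rule open_halfspace_Re_gt)
    show "connected {z. 0 < Re z}" by (intro convex_connected convex_halfspace_Re_gt)
    show "1 islimpt complex_of_real ` {0<..}"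
      unfolding islimpt_sequential
    proof (intro exI conjI allI)
      show "complex_of_real (1 + 1 / real (Suc n)) \<in> of_real ` {0<..} - {1}" for n
        by (auto simp: field_simps intro!: image_eqI[where x = "1 + 1 / real (Suc n)"])
      have "(\<lambda>n. complex_of_real (1 + 1 / real (Suc n))) \<longlonglongrightarrow> of_real (1 + 0)"
        by (intro tendsto_intros lim_1_over_n[THEN LIMSEQ_Suc])
      then show "(\<lambda>n. complex_of_real (1 + 1 / real (Suc n))) \<longlonglongrightarrow> 1"
        by simp
    qed
  qed (use zero z in auto)
  then show ?thesis using L_eq[OF z] by (simp add: E_def)
qed

section \<open>The exponent of the tilted and centred law\<close>

definition laplace :: "complex \<Rightarrow> complex" where
  "laplace z = (\<integral>s. 1 - exp (- (z * complex_of_real s)) \<partial>N)"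

text \<open>This is \<Psi> at tilt \<open>u\<close>. It is defined by values of
  \<open>laplace\<close>, as it comes out of the characteristic function of the tilted law; the term
  with \<open>moment 1 u\<close> removes the mean. The integral form is recovered in
  \<open>centred_exponent_eq\<close>.\<close>

definition centred_exponent :: "real \<Rightarrow> real \<Rightarrow> complex" where
  "centred_exponent \<xi> u = laplace (of_real u) - laplace (of_real u - \<i> * of_real \<xi>) - \<i> * of_real (\<xi> * moment 1 u)"

lemma centred_exponent_eq:
  assumes u: "0 < u"
  shows "integrable N (\<lambda>s. (iexp (\<xi> * s) - 1 - \<i> * of_real (\<xi> * s)) * of_real (exp (- u * s)))" (is ?I)
    and "centred_exponent \<xi> u = (\<integral>s. (iexp (\<xi> * s) - 1 - \<i> * of_real (\<xi> * s)) * of_real (exp (- u * s)) \<partial>N)" (is ?E)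
proof -
  let ?z = "of_real u - \<i> * of_real \<xi>"
  have int: "integrable N (\<lambda>s. 1 - exp (- (complex_of_real u * of_real s)))"
    "integrable N (\<lambda>s. 1 - exp (- (?z * of_real s)))"
    "integrable N (\<lambda>s. \<i> * of_real \<xi> * of_real (s ^ 1 * exp (- u * s)))"
    using u integrable_moment[of u 1]
    by (intro integrable_laplace integrable_mult_right integrable_of_real; simp)+
  have pt: "(iexp (\<xi> * s) - 1 - \<i> * of_real (\<xi> * s)) * of_real (exp (- u * s))
     = (1 - exp (- (complex_of_real u * of_real s))) - (1 - exp (- (?z * of_real s)))
       - \<i> * of_real \<xi> * of_real (s ^ 1 * exp (- u * s))" for s
    by (simp add: algebra_simps flip: exp_of_real exp_add)
  show ?I unfolding pt by (intro Bochner_Integration.integrable_diff int)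
  have mom: "\<i> * of_real (\<xi> * moment 1 u) = (\<integral>s. \<i> * of_real \<xi> * of_real (s ^ 1 * exp (- u * s)) \<partial>N)"
    unfolding integral_mult_right_zero integral_complex_of_real moment_def by simp
  show ?E
    unfolding pt centred_exponent_def laplace_def mom
    by (simp only: Bochner_Integration.integral_diff[OF Bochner_Integration.integrable_diff[OF int(1,2)] int(3)]
        Bochner_Integration.integral_diff[OF int(1,2)])
qed

text \<open>Adding the quadratic term leaves the third order Taylor remainder of
  \<open>iexp (\<xi> * s)\<close> under the integral, which is at most
  \<open>\<bar>\<xi> * s\<bar> ^ 3 / 6\<close>.\<close>

lemma norm_centred_exponent_le:
  assumes u: "0 < u"
  shows "norm (centred_exponent \<xi> u + of_real (\<xi>\<^sup>2 / 2 * moment 2 u)) \<le> \<bar>\<xi>\<bar> ^ 3 / 6 * moment 3 u"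
proof -
  let ?f = "\<lambda>s. (iexp (\<xi> * s) - 1 - \<i> * of_real (\<xi> * s)) * of_real (exp (- u * s))"
  let ?g = "\<lambda>s. complex_of_real (\<xi>\<^sup>2 / 2 * (s ^ 2 * exp (- u * s)))"
  have int: "integrable N ?g" "integrable N (\<lambda>s. \<bar>\<xi>\<bar> ^ 3 / 6 * (s ^ 3 * exp (- u * s)))"
    using integrable_moment[of u 2] integrable_moment[of u 3] u
    by (intro integrable_of_real integrable_mult_right; simp)+
  have eq: "centred_exponent \<xi> u + of_real (\<xi>\<^sup>2 / 2 * moment 2 u) = (\<integral>s. ?f s + ?g s \<partial>N)"
  proof -
    have "of_real (\<xi>\<^sup>2 / 2 * moment 2 u) = (\<integral>s. ?g s \<partial>N)"
      unfolding integral_complex_of_real moment_def by simp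
    then show ?thesis
      using centred_exponent_eq[OF u, of \<xi>] int by (simp only: Bochner_Integration.integral_add)
  qed
  have "norm (centred_exponent \<xi> u + of_real (\<xi>\<^sup>2 / 2 * moment 2 u)) \<le> (\<integral>s. norm (?f s + ?g s) \<partial>N)"
    unfolding eq by (rule integral_norm_bound)
  also have "\<dots> \<le> (\<integral>s. \<bar>\<xi>\<bar> ^ 3 / 6 * (s ^ 3 * exp (- u * s)) \<partial>N)"
  proof (rule integral_mono_AE)
    show "integrable N (\<lambda>s. norm (?f s + ?g s))"
      by (rule integrable_norm[OF Bochner_Integration.integrable_add[OF centred_exponent_eq(1)[OF u, of \<xi>] int(1)]])
    show "AE s in N. norm (?f s + ?g s) \<le> \<bar>\<xi>\<bar> ^ 3 / 6 * (s ^ 3 * exp (- u * s))"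
      using AE_pos
    proof eventually_elim
      case (elim s)
      let ?x = "\<xi> * s"
      have "(\<Sum>j\<le>2. (\<i> * of_real ?x) ^ j / fact j) = 1 + \<i> * of_real ?x - of_real (?x\<^sup>2 / 2)"
      proof -
        have "{..2::nat} = {0, 1, 2}" by auto
        then show ?thesis by (simp add: power_mult_distrib)
      qed
      then have "norm (iexp ?x - (1 + \<i> * of_real ?x - of_real (?x\<^sup>2 / 2))) \<le> \<bar>?x\<bar> ^ 3 / 6"
        using iexp_approx1[of ?x 2] by (simp add: fact_numeral)
      then have "norm (iexp ?x - (1 + \<i> * of_real ?x - of_real (?x\<^sup>2 / 2))) * exp (- u * s)
          \<le> \<bar>?x\<bar> ^ 3 / 6 * exp (- u * s)"
        by (rule mult_right_mono) simp
      moreover have "?f s + ?g s = (iexp ?x - (1 + \<i> * of_real ?x - of_real (?x\<^sup>2 / 2))) * of_real (exp (- u * s))"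
        by (simp add: algebra_simps power_mult_distrib)
      then have "norm (?f s + ?g s) = norm (iexp ?x - (1 + \<i> * of_real ?x - of_real (?x\<^sup>2 / 2))) * exp (- u * s)"
        by (simp only: norm_mult norm_of_real abs_exp_cancel)
      ultimately show ?case
        using elim by (simp add: abs_mult power_mult_distrib)
    qed
  qed (rule int)
  also have "\<dots> = \<bar>\<xi>\<bar> ^ 3 / 6 * moment 3 u" by (simp add: moment_def)
  finally show ?thesis .
qed

lemma measurable_centred_exponent:
  assumes u: "0 < u" and sf: "sigma_finite_measure N"
  shows "(\<lambda>\<xi>. centred_exponent \<xi> u) \<in> borel_measurable borel"
proof -
  interpret sigma_finite_measure N by fact
  show ?thesis unfolding centred_exponent_eq(2)[OF u] by measurable
qed

section \<open>Inversion of the tilted density\<close>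

text \<open>Multiplying the density by \<open>exp (- u * y)\<close> and by the inverse of its
  Laplace transform at \<open>u\<close> gives a probability density whose characteristic function is
  read off from the transform at \<open>u - \<i> * \<xi>\<close>. The choice
  \<open>x = t * moment 1 u\<close> is the mean of the tilted law, so inversion at \<open>x\<close>
  cancels the linear phase exactly.\<close>

lemma density_by_inversion:
  fixes p :: "real \<Rightarrow> real" and t u x :: real
  assumes P: "prob_space P"
    and p: "\<And>y. 0 < y \<Longrightarrow> 0 \<le> p y" "continuous_on {0<..} p"
    and X: "distributed P lborel X (\<lambda>y. ennreal (indicator {0<..} y * p y))"
    and lap: "\<And>v. 0 < v \<Longrightarrow> (\<integral>\<omega>. exp (- v * X \<omega>) \<partial>P) = exp (- t * (\<integral>s. 1 - exp (- v * s) \<partial>N))"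
    and u: "0 < u" and x: "x = t * moment 1 u" "0 < x"
    and int: "integrable lborel (\<lambda>\<xi>. exp (of_real t * centred_exponent \<xi> u))"
  shows "complex_of_real (p x * exp (t * (\<integral>s. 1 - exp (- u * s) \<partial>N) - u * x))
      = 1 / (2 * pi) * (\<integral>\<xi>. exp (of_real t * centred_exponent \<xi> u) \<partial>lborel)"
proof -
  interpret P: prob_space P by fact
  define \<phi> where "\<phi> = (\<integral>s. 1 - exp (- u * s) \<partial>N)"
  \<comment> \<open>Extension by zero, since \<open>p\<close> is controlled only on the positive
    half-line.\<close>
  define r where "r y = indicator {0<..} y * p y" for y
  have r_meas [measurable]: "r \<in> borel_measurable borel"
    using borel_measurable_continuous_on_indicator[OF _ p(2)] by (simp add: r_def[abs_def])
  have r_nonneg: "0 \<le> r y" for y using p(1) by (simp add: r_def indicator_def)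
  define D where "D = density lborel (\<lambda>y. ennreal (r y))"
  have D_eq: "D = distr P lborel X" and X_meas [measurable]: "X \<in> borel_measurable P"
    using X by (auto simp: distributed_def D_def r_def)
  have [measurable_cong]: "sets D = sets borel" by (simp add: D_def)
  have D_prob: "prob_space D" unfolding D_eq by (rule P.prob_space_distr) simp
  have D_pos: "AE y in D. 0 < y"
  proof -
    have "AE y in lborel. 0 < ennreal (r y) \<longrightarrow> 0 < y"
      by (rule AE_I2) (simp add: r_def indicator_def)
    then show ?thesis unfolding D_def by (subst AE_density) auto
  qed
  have D_lap: "(\<integral>y. exp (- (z * complex_of_real y)) \<partial>D) = exp (- of_real t * laplace z)" if "0 < Re z" for z
    unfolding laplace_def
  proof (rule laplace_transform_eqI[OF _ _ D_pos _ that])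
    show "(\<integral>y. exp (- v * y) \<partial>D) = exp (- t * (\<integral>s. 1 - exp (- v * s) \<partial>N))" if "0 < v" for v
      unfolding D_eq lap[OF that, symmetric] by (rule integral_distr) auto
    show "finite_measure D" using D_prob by (rule prob_space.finite_measure)
  qed (simp add: D_def)
  define q where "q y = r y * exp (- u * y) * exp (t * \<phi>)" for y
  have q_meas [measurable]: "q \<in> borel_measurable borel" unfolding q_def by measurable
  have q_nonneg: "0 \<le> q y" for y using r_nonneg by (simp add: q_def)
  define Q where "Q = density lborel (\<lambda>y. ennreal (q y))"
  have laplace_real: "laplace (of_real u) = of_real \<phi>"
    unfolding laplace_def \<phi>_def by (simp flip: integral_complex_of_real exp_of_real)
  have char_Q: "char Q \<xi> = iexp (\<xi> * x) * exp (of_real t * centred_exponent \<xi> u)" for \<xi>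
  proof -
    let ?z = "of_real u - \<i> * of_real \<xi> :: complex"
    have "char Q \<xi> = (\<integral>y. q y *\<^sub>R iexp (\<xi> * y) \<partial>lborel)"
      unfolding char_def Q_def by (subst integral_density) (use q_nonneg in auto)
    also have "\<dots> = (\<integral>y. of_real (exp (t * \<phi>)) * (r y *\<^sub>R exp (- (?z * of_real y))) \<partial>lborel)"
      by (intro Bochner_Integration.integral_cong)
        (simp_all add: q_def scaleR_conv_of_real algebra_simps flip: exp_of_real exp_add)
    also have "\<dots> = of_real (exp (t * \<phi>)) * (\<integral>y. exp (- (?z * of_real y)) \<partial>D)"
      unfolding D_def integral_mult_right_zero
      by (subst integral_density) (use r_nonneg in auto)
    also have "\<dots> = of_real (exp (t * \<phi>)) * exp (- of_real t * laplace ?z)"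
      by (subst D_lap) (use u in auto)
    also have "\<dots> = iexp (\<xi> * x) * exp (of_real t * centred_exponent \<xi> u)"
      unfolding centred_exponent_def laplace_real x(1)
      by (simp add: algebra_simps flip: exp_of_real exp_add)
    finally show ?thesis .
  qed
  have Q_prob: "prob_space Q"
  proof
    have "(\<integral>y. exp (- (of_real u * complex_of_real y)) \<partial>D) = of_real (\<integral>y. exp (- u * y) \<partial>D)"
      by (simp flip: integral_complex_of_real exp_of_real)
    then have "complex_of_real (\<integral>y. exp (- u * y) \<partial>D) = exp (- of_real t * of_real \<phi>)"
      using D_lap[of "of_real u"] u unfolding laplace_real by simp
    also have "\<dots> = of_real (exp (- t * \<phi>))"
      by (simp flip: exp_of_real)
    \<comment> \<open>The transform at \<open>u\<close> is the normalizing constant of the tilt,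
      which gives \<open>Q\<close> total mass 1.\<close>
    finally have lap_u: "(\<integral>y. exp (- u * y) \<partial>D) = exp (- t * \<phi>)"
      by (simp only: of_real_eq_iff)
    have int_D: "integrable D (\<lambda>y. exp (- u * y))"
    proof -
      interpret D: prob_space D by fact
      show ?thesis
        by (rule D.integrable_const_bound[where B = 1])
          (use D_pos u in \<open>auto elim!: eventually_mono\<close>)
    qed
    have "emeasure Q (space Q) = (\<integral>\<^sup>+y. ennreal (q y) \<partial>lborel)"
      by (simp add: Q_def emeasure_density)
    also have "\<dots> = (\<integral>\<^sup>+y. ennreal (exp (- u * y) * exp (t * \<phi>)) \<partial>D)"
      unfolding D_def by (subst nn_integral_density) (auto simp: q_def r_nonneg mult_ac ennreal_mult' intro!: nn_integral_cong)
    also have "\<dots> = ennreal (\<integral>y. exp (- u * y) * exp (t * \<phi>) \<partial>D)"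
      by (rule nn_integral_eq_integral) (use int_D in auto)
    also have "(\<integral>y. exp (- u * y) * exp (t * \<phi>) \<partial>D) = 1"
      unfolding integral_mult_left_zero lap_u by (simp flip: exp_add)
    finally show "emeasure Q (space Q) = 1" by simp
  qed
  have char_meas: "char Q \<in> borel_measurable borel"
  proof -
    interpret Q: prob_space Q by (fact Q_prob)
    interpret Q: real_distribution Q by unfold_locales (simp_all add: Q_def)
    show ?thesis by simp
  qed
  have "integrable lborel (char Q)"
    by (rule Bochner_Integration.integrable_bound[OF int])
      (use char_meas in \<open>auto simp: char_Q norm_mult\<close>)
  moreover have "isCont q x"
  proof -
    have "continuous_on {0<..} (\<lambda>y. p y * exp (- u * y) * exp (t * \<phi>))"
      by (intro continuous_intros p)
    then have "continuous_on {0<..} q"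
      by (rule continuous_on_cong[THEN iffD1, rotated 2]) (auto simp: q_def r_def)
    then show ?thesis using x(2) by (simp add: continuous_on_eq_continuous_at)
  qed
  ultimately have "complex_of_real (q x) = 1 / (2 * pi) * (\<integral>\<xi>. iexp (- (\<xi> * x)) * char Q \<xi> \<partial>lborel)"
    using Q_prob unfolding Q_def by (intro fourier_inversion q_meas q_nonneg) auto
  also have "(\<lambda>\<xi>. iexp (- (\<xi> * x)) * char Q \<xi>) = (\<lambda>\<xi>. exp (of_real t * centred_exponent \<xi> u))"
    by (rule ext) (simp add: char_Q flip: exp_add)
  also have "q x = p x * exp (t * \<phi> - u * x)"
    using x(2) by (simp add: q_def r_def mult_ac flip: exp_add)
  finally show ?thesis by (simp add: \<phi>_def)
qed

section \<open>Range of the derivative of the exponent\<close>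

lemma moment1_tendsto_0: "((moment 1) \<longlongrightarrow> 0) at_top"
proof -
  \<comment> \<open>Replacing \<open>u\<close> by \<open>max 1 u\<close> makes the dominating
    function \<open>s * exp (- s)\<close> valid for all \<open>u\<close> and changes nothing for
    large \<open>u\<close>.\<close>
  have "((\<lambda>u. \<integral>s. s ^ 1 * exp (- max 1 u * s) \<partial>N) \<longlongrightarrow> (\<integral>s. 0 \<partial>N)) at_top"
  proof (rule integral_dominated_convergence_at_top[where w = "\<lambda>s. s ^ 1 * exp (- 1 * s)"])
    show "\<forall>\<^sub>F u in at_top. AE s in N. norm (s ^ 1 * exp (- max 1 u * s)) \<le> s ^ 1 * exp (- 1 * s)"
    proof (rule always_eventually, rule allI)
      fix u :: real
      show "AE s in N. norm (s ^ 1 * exp (- max 1 u * s)) \<le> s ^ 1 * exp (- 1 * s)"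
        using AE_pos
      proof eventually_elim
        case (elim s)
        then have "1 * s \<le> max 1 u * s" by (intro mult_right_mono) auto
        then show ?case using elim by (simp add: abs_mult)
      qed
    qed
    show "AE s in N. ((\<lambda>u. s ^ 1 * exp (- max 1 u * s)) \<longlongrightarrow> 0) at_top"
      using AE_pos
    proof eventually_elim
      case (elim s)
      have "((\<lambda>u. s * exp (- u * s)) \<longlongrightarrow> 0) at_top" using elim by real_asymp
      moreover have "\<forall>\<^sub>F u in at_top. s * exp (- u * s) = s ^ 1 * exp (- max 1 u * s)"
        using eventually_ge_at_top[of 1] by eventually_elim (simp add: max_def)
      ultimately show ?case by (rule Lim_transform_eventually)
    qed
  qed (use integrable_moment[of 1 1] in auto)
  moreover have "\<forall>\<^sub>F u in at_top. (\<integral>s. s ^ 1 * exp (- max 1 u * s) \<partial>N) = moment 1 u"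
    using eventually_ge_at_top[of 1] by eventually_elim (simp add: moment_def max_def)
  ultimately show ?thesis by (simp add: Lim_transform_eventually)
qed

lemma moment1_antimono:
  assumes "0 < u" "u \<le> v"
  shows "moment 1 v \<le> moment 1 u"
  unfolding moment_def
proof (rule integral_mono_AE)
  show "AE s in N. s ^ 1 * exp (- v * s) \<le> s ^ 1 * exp (- u * s)"
    using AE_pos by eventually_elim (use assms in \<open>auto intro!: mult_left_mono mult_right_mono\<close>)
qed (rule integrable_moment; use assms in simp)+

text \<open>Intermediate value theorem between \<open>u\<close> and a point so large that the first
  moment is below \<open>y\<close>. It ensures that the inverse of the derivative in
  \<open>sigma_fun\<close> is taken at a point of its range.\<close>

lemma ex_moment1_eq:
  assumes "0 < u" "0 < y" "y < moment 1 u"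
  shows "\<exists>v>0. moment 1 v = y"
proof -
  have "\<forall>\<^sub>F v in at_top. moment 1 v < y"
    using moment1_tendsto_0 assms(2) by (rule order_tendstoD)
  then obtain v where v: "u \<le> v" "moment 1 v < y"
    using eventually_ge_at_top[of u] by (metis (mono_tags, lifting) eventually_at_top_linorder nle_le order_trans)
  have "\<exists>w\<ge>u. w \<le> v \<and> moment 1 w = y"
  proof (rule IVT2)
    show "\<forall>w. u \<le> w \<and> w \<le> v \<longrightarrow> isCont (moment 1) w"
      using assms(1) by (intro allI impI DERIV_isCont[OF has_derivative_moment]) auto
  qed (use assms v in auto)
  then obtain w where "u \<le> w" "moment 1 w = y" by blast
  then show ?thesis using assms(1) by (intro exI[of _ w]) simp
qed

end

section \<open>Consequences of the scaling condition\<close>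

text \<open>
  For a fixed dilation \<open>l\<close> the factor \<open>1 - cos (x * l)\<close> vanishes at arbitrarily large \<open>x\<close>; its average over
  \<open>l\<close> does not.
\<close>

lemma averaged_one_minus_cos:
  fixes x :: real
  shows "ennreal (min 1 (x\<^sup>2) / 240) \<le> (\<integral>\<^sup>+l. ennreal (1 - cos (x * l)) * indicator {1/2..1} l \<partial>lborel)"
proof (cases "x = 0")
  case False
  \<comment> \<open>The identity
    \<open>sin x - sin (x / 2) = 2 * sin (x / 4) * cos (3 * x / 4)\<close> makes a quarter of
    \<open>x\<close> the natural variable.\<close>
  define y where "y = \<bar>x\<bar> / 4"
  have y: "0 < y" "x\<^sup>2 = 16 * y\<^sup>2" using False by (auto simp: y_def power_divide)
  have "(\<integral>\<^sup>+l. ennreal (1 - cos (x * l)) * indicator {1/2..1} l \<partial>lborel)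
      = ennreal ((1 - sin (x * 1) / x) - (1/2 - sin (x * (1/2)) / x))"
    by (rule nn_integral_FTC_Icc[where F = "\<lambda>l. l - sin (x * l) / x"])
      (use False in \<open>auto intro!: derivative_eq_intros\<close>)
  also have "(1 - sin (x * 1) / x) - (1/2 - sin (x * (1/2)) / x) = 1/2 - (sin x - sin (x / 2)) / x"
    by (simp add: diff_divide_distrib)
  finally have integral_eq: "(\<integral>\<^sup>+l. ennreal (1 - cos (x * l)) * indicator {1/2..1} l \<partial>lborel)
      = ennreal (1/2 - (sin x - sin (x / 2)) / x)" .
  have "\<bar>sin x - sin (x / 2)\<bar> \<le> 2 * \<bar>sin (x / 4)\<bar>"
    using sin_diff_sin[of x "x / 2"] abs_cos_le_one[of "3 * x / 4"]
    by (simp add: abs_mult mult_left_le field_simps)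
  also have "\<bar>sin (x / 4)\<bar> = \<bar>sin y\<bar>"
    by (cases "0 \<le> x") (simp_all add: y_def)
  finally have "\<bar>(sin x - sin (x / 2)) / x\<bar> \<le> \<bar>sin y\<bar> / (2 * y)"
    using y(1) by (simp add: y_def abs_divide field_simps)
  \<comment> \<open>For \<open>y \<le> 2\<close> the Taylor polynomial of sine with fifth order
    remainder gives \<open>sin y \<le> y - 2 / 15 * y ^ 3\<close>, hence a gap of at least
    \<open>y ^ 2 / 15\<close>, which is \<open>16 * y ^ 2 / 240\<close>: this fixes the constant
    240. For \<open>y > 2\<close> the gap is at least 1/4.\<close>
  moreover have "min 1 (16 * y\<^sup>2) / 240 \<le> 1/2 - \<bar>sin y\<bar> / (2 * y)"
  proof (cases "y \<le> 2")
    case True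
    have sum_eq: "(\<Sum>m<5. sin_coeff m * y ^ m) = y - y ^ 3 / 6"
    proof -
      have "{..<5::nat} = {0, 1, 2, 3, 4}" by auto
      then show ?thesis by (simp add: sin_coeff_def fact_numeral)
    qed
    have "\<bar>sin y - (y - y ^ 3 / 6)\<bar> \<le> y ^ 5 / 120"
      using Maclaurin_sin_bound[of y 5] y(1) unfolding sum_eq by (simp add: fact_numeral)
    moreover have "y ^ 5 \<le> 4 * y ^ 3"
    proof -
      have "y ^ 2 \<le> 2 ^ 2" using True y(1) by (intro power_mono) auto
      then have "y ^ 3 * y ^ 2 \<le> y ^ 3 * 4" using y(1) by (intro mult_left_mono) auto
      then show ?thesis by (simp flip: power_add)
    qed
    ultimately have "sin y \<le> y - 2 / 15 * y ^ 3"
      by linarith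
    moreover have "0 \<le> sin y" using True y(1) pi_gt3 by (intro sin_ge_zero) auto
    ultimately have "\<bar>sin y\<bar> / (2 * y) \<le> (y - 2 / 15 * y ^ 3) / (2 * y)"
      using y(1) by (intro divide_right_mono) auto
    also have "\<dots> = 1/2 - y\<^sup>2 / 15"
      using y(1) by (simp add: field_simps power2_eq_square power3_eq_cube)
    finally show ?thesis by (simp add: min_def)
  next
    case False
    have "\<bar>sin y\<bar> / (2 * y) \<le> 1 / (2 * y)"
      using y(1) by (intro divide_right_mono) auto
    also have "\<dots> \<le> 1 / 4" using False by (simp add: field_simps)
    finally show ?thesis by (simp add: min_def)
  qed
  ultimately have "min 1 (x\<^sup>2) / 240 \<le> 1/2 - (sin x - sin (x / 2)) / x"
    unfolding y(2) by linarith
  then show ?thesis unfolding integral_eq by (rule ennreal_leI)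
qed simp

text \<open>It suffices that \<open>y \<le> exp (y / 2)\<close>, which follows from
  \<open>exp (y / 2) = exp 1 * exp (y / 2 - 1)\<close> and the tangent line bound for
  \<open>exp\<close>. It lets an exponential weight be traded for the truncation at 1.\<close>

lemma square_times_exp_le_min:
  fixes y :: real
  assumes "0 \<le> y"
  shows "y\<^sup>2 * exp (- y) \<le> min 1 (y\<^sup>2)"
proof -
  have "y / 2 \<le> exp (y / 2 - 1)"
    using exp_ge_add_one_self[of "y / 2 - 1"] by linarith
  moreover have "2 \<le> exp (1 :: real)" using exp_ge_add_one_self[of "1 :: real"] by linarith
  ultimately have "2 * (y / 2) \<le> exp 1 * exp (y / 2 - 1)" using assms by (intro mult_mono) auto
  then have "y \<le> exp (y / 2)" by (simp flip: exp_add)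
  then have "y\<^sup>2 \<le> (exp (y / 2))\<^sup>2" using assms by (intro power_mono)
  also have "\<dots> = exp y" by (simp add: power2_eq_square flip: exp_add)
  finally have "y\<^sup>2 * exp (- y) \<le> 1" by (simp add: exp_minus field_simps)
  moreover have "y\<^sup>2 * exp (- y) \<le> y\<^sup>2" using assms by (simp add: mult_left_le)
  ultimately show ?thesis by simp
qed

section \<open>Rescaling and comparison of moments\<close>

text \<open>Here \<open>k\<close> is the Levy density extended by zero. Of the power-type scaling
  condition only its effect on dilations by factors between 1/2 and 1 is retained.\<close>

locale doubling_levy_density =
  fixes k :: "real \<Rightarrow> real" and \<kappa> R :: real
  assumes k_meas [measurable]: "k \<in> borel_measurable borel"
    and k_nonneg: "0 \<le> k s"
    and k_eq_0: "s \<le> 0 \<Longrightarrow> k s = 0"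
    and k_integrable: "integrable lborel (\<lambda>s. min 1 s * k s)"
    and \<kappa>_pos: "0 < \<kappa>" and R_pos: "0 < R"
    and k_pos: "0 < s \<Longrightarrow> s \<le> R \<Longrightarrow> 0 < k s"
    and k_scale: "0 < s \<Longrightarrow> s \<le> R \<Longrightarrow> 1/2 \<le> l \<Longrightarrow> l \<le> 1 \<Longrightarrow> \<kappa> * k s \<le> k (l * s)"
begin

definition N :: "real measure" where "N = density lborel (\<lambda>s. ennreal (k s))"

lemma sets_levy_measure [measurable_cong, simp]: "sets N = sets borel"
  by (simp add: N_def)

lemma integral_N:
  fixes g :: "real \<Rightarrow> 'b::{banach, second_countable_topology}"
  assumes [measurable]: "g \<in> borel_measurable borel"
  shows "integrable N g \<longleftrightarrow> integrable lborel (\<lambda>s. k s *\<^sub>R g s)"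
    and "(\<integral>s. g s \<partial>N) = (\<integral>s. k s *\<^sub>R g s \<partial>lborel)"
  unfolding N_def using k_nonneg by (auto simp: integrable_density integral_density)

lemma nn_integral_N:
  assumes [measurable]: "g \<in> borel_measurable borel"
  shows "(\<integral>\<^sup>+s. g s \<partial>N) = (\<integral>\<^sup>+s. ennreal (k s) * g s \<partial>lborel)"
  unfolding N_def by (simp add: nn_integral_density)

sublocale levy_like_measure N
proof
  show "AE s in N. 0 < s"
    unfolding N_def by (subst AE_density) (auto intro!: AE_I2 simp: not_le[symmetric] k_eq_0)
  show "integrable N (\<lambda>s. min 1 s)"
    using k_integrable by (simp add: integral_N mult.commute)
qed simp

lemma sigma_finite_N: "sigma_finite_measure N"
  unfolding N_def by (subst sigma_finite_measure.sigma_finite_iff_density_finite[OF sigma_finite_lborel]) auto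

text \<open>Substitute \<open>l * s\<close> for \<open>s\<close>: the density costs a factor
  \<open>1 / \<kappa>\<close>, the Jacobian \<open>1 / l\<close> at most 2, and \<open>l * s\<close>
  stays in the range where scaling holds.\<close>

lemma nn_integral_rescale_le:
  fixes g :: "real \<Rightarrow> ennreal"
  assumes [measurable]: "g \<in> borel_measurable borel" and l: "1/2 \<le> l" "l \<le> 1"
  shows "(\<integral>\<^sup>+s. g (l * s) * indicator {0<..R} s \<partial>N)
      \<le> ennreal (2 / \<kappa>) * (\<integral>\<^sup>+s. g s * indicator {0<..R} s \<partial>N)"
proof -
  let ?G = "\<lambda>s. ennreal (k s) * (g s * indicator {0<..R} s)"
  have "(\<integral>\<^sup>+s. g (l * s) * indicator {0<..R} s \<partial>N)
      = (\<integral>\<^sup>+s. ennreal (k s) * (g (l * s) * indicator {0<..R} s) \<partial>lborel)"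
    by (simp add: nn_integral_N)
  also have "\<dots> \<le> (\<integral>\<^sup>+s. ennreal (1 / \<kappa>) * ?G (l * s) \<partial>lborel)"
  proof (rule nn_integral_mono)
    fix s :: real
    show "ennreal (k s) * (g (l * s) * indicator {0<..R} s) \<le> ennreal (1 / \<kappa>) * ?G (l * s)"
    proof (cases "s \<in> {0<..R}")
      case True
      have "l * s \<le> 1 * s" using True l by (intro mult_right_mono) auto
      also have "\<dots> \<le> R" using True by simp
      finally have ls: "l * s \<in> {0<..R}" using True l by simp
      have "k s \<le> 1 / \<kappa> * k (l * s)"
        using k_scale[of s l] True l \<kappa>_pos by (simp add: field_simps)
      then have "ennreal (k s) \<le> ennreal (1 / \<kappa>) * ennreal (k (l * s))"
        using \<kappa>_pos k_nonneg by (simp flip: ennreal_mult' add: ennreal_leI)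
      then show ?thesis using True ls by (simp add: mult_right_mono flip: mult.assoc)
    qed simp
  qed
  also have "\<dots> = ennreal (1 / \<kappa>) * (\<integral>\<^sup>+s. ?G (l * s) \<partial>lborel)"
    by (rule nn_integral_cmult) measurable
  also have "(\<integral>\<^sup>+s. ?G s \<partial>lborel) = ennreal l * (\<integral>\<^sup>+s. ?G (l * s) \<partial>lborel)"
    using nn_integral_real_affine[of ?G l 0] l by simp
  then have "(\<integral>\<^sup>+s. ?G (l * s) \<partial>lborel) = ennreal (1 / l) * (\<integral>\<^sup>+s. ?G s \<partial>lborel)"
    using l by (simp flip: mult.assoc ennreal_mult')
  also have "ennreal (1 / \<kappa>) * (ennreal (1 / l) * (\<integral>\<^sup>+s. ?G s \<partial>lborel)) \<le> ennreal (1 / \<kappa>) * (ennreal 2 * (\<integral>\<^sup>+s. ?G s \<partial>lborel))"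
    using l by (intro mult_left_mono mult_right_mono ennreal_leI) (auto simp: field_simps)
  also have "\<dots> = ennreal (2 / \<kappa>) * (\<integral>\<^sup>+s. ?G s \<partial>lborel)"
    using \<kappa>_pos by (simp flip: mult.assoc ennreal_mult' del: ennreal_numeral)
  finally show ?thesis by (simp add: nn_integral_N)
qed

definition truncated_moment2 :: "real \<Rightarrow> real" where
  "truncated_moment2 u = (\<integral>s. s\<^sup>2 * exp (- u * s) * indicator {0<..R} s \<partial>N)"

lemma integrable_truncated:
  assumes "0 < u" "A \<in> sets borel"
  shows "integrable N (\<lambda>s. s\<^sup>2 * exp (- u * s) * indicator A s)"
  using integrable_moment[of u 2] assms by (intro integrable_real_mult_indicator) auto

lemma truncated_moment2_nonneg: "0 \<le> truncated_moment2 u"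
  unfolding truncated_moment2_def by (rule integral_nonneg_AE) auto

text \<open>Rescaling with \<open>l = 1/2\<close> turns the exponent \<open>u / 2\<close> into
  \<open>u\<close>; the square contributes 4 and the rescaling bound
  \<open>2 / \<kappa>\<close>.\<close>

lemma truncated_moment2_half_le:
  assumes "0 < u"
  shows "truncated_moment2 (u / 2) \<le> 8 / \<kappa> * truncated_moment2 u"
proof -
  define g where "g s = ennreal (4 * (s\<^sup>2 * exp (- u * s)))" for s :: real
  have [measurable]: "g \<in> borel_measurable borel" unfolding g_def by measurable
  have "ennreal (truncated_moment2 (u / 2)) = (\<integral>\<^sup>+s. ennreal (s\<^sup>2 * exp (- (u / 2) * s) * indicator {0<..R} s) \<partial>N)"
    unfolding truncated_moment2_def
    by (rule nn_integral_eq_integral[symmetric]) (use integrable_truncated[of "u / 2"] assms in auto)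
  also have "\<dots> = (\<integral>\<^sup>+s. g (1/2 * s) * indicator {0<..R} s \<partial>N)"
    by (intro nn_integral_cong) (auto simp: g_def indicator_def power_divide)
  also have "\<dots> \<le> ennreal (2 / \<kappa>) * (\<integral>\<^sup>+s. g s * indicator {0<..R} s \<partial>N)"
    by (rule nn_integral_rescale_le) auto
  also have "(\<integral>\<^sup>+s. g s * indicator {0<..R} s \<partial>N) = (\<integral>\<^sup>+s. ennreal (4 * (s\<^sup>2 * exp (- u * s) * indicator {0<..R} s)) \<partial>N)"
    by (intro nn_integral_cong) (auto simp: g_def indicator_def)
  also have "\<dots> = ennreal (\<integral>s. 4 * (s\<^sup>2 * exp (- u * s) * indicator {0<..R} s) \<partial>N)"
    by (rule nn_integral_eq_integral) (use integrable_truncated[of u "{0<..R}"] assms in auto)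
  also have "\<dots> = ennreal (4 * truncated_moment2 u)"
    by (simp add: truncated_moment2_def)
  also have "ennreal (2 / \<kappa>) * \<dots> = ennreal (8 / \<kappa> * truncated_moment2 u)"
    using \<kappa>_pos truncated_moment2_nonneg[of u] by (simp flip: ennreal_mult')
  finally show ?thesis
    using \<kappa>_pos truncated_moment2_nonneg[of u] by (subst (asm) ennreal_le_iff) auto
qed

lemma integrable_square_near_0: "integrable N (\<lambda>s. s\<^sup>2 * indicator {0<..R/4} s)"
proof (rule integrable_le_min)
  fix s :: real assume s: "0 < s"
  let ?c = "R / 4"
  have "s\<^sup>2 \<le> (?c + ?c\<^sup>2) * min 1 s" if "s \<le> ?c"
  proof -
    have "s * s \<le> ?c * s" "s * s \<le> ?c * ?c"
      using that s by (intro mult_mono; simp)+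
    moreover have "0 \<le> ?c\<^sup>2 * s" "0 < ?c" using s R_pos by auto
    ultimately show ?thesis by (simp add: min_def distrib_right power2_eq_square)
  qed
  then show "norm (s\<^sup>2 * indicator {0<..?c} s) \<le> (?c + ?c\<^sup>2) * min 1 s"
    using s R_pos by (simp add: indicator_def)
qed simp

lemma integral_square_near_0_pos: "0 < (\<integral>s. s\<^sup>2 * indicator {0<..R/4} s \<partial>N)"
proof -
  have "(\<integral>s. s\<^sup>2 * indicator {0<..R/4} s \<partial>N) \<noteq> 0"
  proof
    assume "(\<integral>s. s\<^sup>2 * indicator {0<..R/4} s \<partial>N) = 0"
    then have "AE s in N. s\<^sup>2 * indicator {0<..R/4} s = 0"
      using integral_nonneg_eq_0_iff_AE[OF integrable_square_near_0] by simp
    then have "AE s in lborel. 0 < k s \<longrightarrow> s\<^sup>2 * indicator {0<..R/4} s = 0"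
      unfolding N_def by (subst (asm) AE_density) auto
    then have "AE s in lborel. s \<notin> {0<..R/4}"
    proof eventually_elim
      case (elim s)
      show ?case
      proof
        assume s: "s \<in> {0<..R/4}"
        then have "0 < k s" using R_pos by (intro k_pos) auto
        then show False using elim s by simp
      qed
    qed
    then have "emeasure lborel {0<..R/4} = 0"
      by (subst (asm) AE_iff_measurable[where N = "{0<..R/4}"]) auto
    then show False using R_pos by simp
  qed
  moreover have "0 \<le> (\<integral>s. s\<^sup>2 * indicator {0<..R/4} s \<partial>N)"
    by (rule integral_nonneg_AE) auto
  ultimately show ?thesis by linarith
qed

text \<open>The first summand pays for the part of the moment on \<open>(0, R]\<close>, where
  scaling is available, the second for the tail beyond \<open>R\<close>, measured against the mass
  near 0.\<close>

definition doubling_const :: real where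
  "doubling_const = 8 / \<kappa> + moment 2 1 / (\<integral>s. s\<^sup>2 * indicator {0<..R/4} s \<partial>N)"

lemma moment_nonneg: "0 \<le> moment n u"
  unfolding moment_def by (rule integral_nonneg_AE) (use AE_pos in eventually_elim, simp)

lemma doubling_const_pos: "0 < doubling_const"
  unfolding doubling_const_def using \<kappa>_pos integral_square_near_0_pos moment_nonneg[of 2 1]
  by (intro add_pos_nonneg) auto

text \<open>Below \<open>R\<close> the rescaling bound applies. Beyond \<open>R\<close> the integral
  is at most a constant times \<open>exp (- (u * R / 4))\<close>, and the part of the moment at
  \<open>u\<close> on \<open>(0, R/4]\<close> is at least a constant times the same exponential, so
  it absorbs the tail.\<close>

lemma moment2_half_le:
  assumes u: "4 \<le> u"
  shows "moment 2 (u / 2) \<le> doubling_const * truncated_moment2 u"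
proof -
  let ?F = "\<integral>s. s\<^sup>2 * indicator {0<..R/4} s \<partial>N"
  have split: "moment 2 (u / 2) = truncated_moment2 (u / 2) + (\<integral>s. s\<^sup>2 * exp (- (u / 2) * s) * indicator {R<..} s \<partial>N)"
  proof -
    have "moment 2 (u / 2) = (\<integral>s. s\<^sup>2 * exp (- (u / 2) * s) * indicator {0<..R} s
        + s\<^sup>2 * exp (- (u / 2) * s) * indicator {R<..} s \<partial>N)"
      unfolding moment_def by (rule integral_cong_AE)
        (use AE_pos R_pos in \<open>auto simp: indicator_def elim!: eventually_mono\<close>)
    also have "\<dots> = truncated_moment2 (u / 2) + (\<integral>s. s\<^sup>2 * exp (- (u / 2) * s) * indicator {R<..} s \<partial>N)"
      unfolding truncated_moment2_def
      by (rule Bochner_Integration.integral_add; rule integrable_truncated) (use u in auto)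
    finally show ?thesis .
  qed
  have tail: "(\<integral>s. s\<^sup>2 * exp (- (u / 2) * s) * indicator {R<..} s \<partial>N) \<le> exp (- (u * R / 4)) * moment 2 1"
  proof -
    have "(\<integral>s. s\<^sup>2 * exp (- (u / 2) * s) * indicator {R<..} s \<partial>N) \<le> (\<integral>s. exp (- (u * R / 4)) * (s\<^sup>2 * exp (- 1 * s)) \<partial>N)"
    proof (rule integral_mono)
      fix s :: real
      show "s\<^sup>2 * exp (- (u / 2) * s) * indicator {R<..} s \<le> exp (- (u * R / 4)) * (s\<^sup>2 * exp (- 1 * s))"
      proof (cases "R < s")
        case True
        \<comment> \<open>This is where \<open>4 \<le> u\<close> enters: it gives
          \<open>u / 2 - 1 \<ge> u / 4\<close>.\<close>
        have "u * R / 4 \<le> (u / 2 - 1) * s"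
        proof -
          have "u / 4 * R \<le> (u / 2 - 1) * s"
            using u True R_pos by (intro mult_mono) auto
          then show ?thesis by simp
        qed
        then have "- (u / 2) * s \<le> - (u * R / 4) + - 1 * s" by (simp add: algebra_simps)
        then have "exp (- (u / 2) * s) \<le> exp (- (u * R / 4)) * exp (- 1 * s)"
          by (simp only: exp_le_cancel_iff flip: exp_add)
        then have "s\<^sup>2 * exp (- (u / 2) * s) \<le> s\<^sup>2 * (exp (- (u * R / 4)) * exp (- 1 * s))"
          by (rule mult_left_mono) simp
        then show ?thesis using True by (simp add: mult_ac)
      qed simp
    qed (use integrable_truncated[of "u / 2" "{R<..}"] integrable_moment[of 1 2] u in auto)
    then show ?thesis by (simp add: moment_def)
  qed
  have low: "exp (- (u * R / 4)) * ?F \<le> truncated_moment2 u"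
  proof -
    have "(\<integral>s. exp (- (u * R / 4)) * (s\<^sup>2 * indicator {0<..R/4} s) \<partial>N) \<le> truncated_moment2 u"
      unfolding truncated_moment2_def
    proof (rule integral_mono)
      fix s :: real
      have "exp (- (u * R / 4)) \<le> exp (- u * s)" if "s \<le> R / 4"
        using mult_left_mono[OF that, of u] u by simp
      then show "exp (- (u * R / 4)) * (s\<^sup>2 * indicator {0<..R/4} s) \<le> s\<^sup>2 * exp (- u * s) * indicator {0<..R} s"
        using R_pos by (auto simp: indicator_def mult.commute[of "exp _"] intro!: mult_left_mono)
    qed (use integrable_truncated[of u "{0<..R}"] integrable_square_near_0 u in auto)
    then show ?thesis by simp
  qed
  have "exp (- (u * R / 4)) * moment 2 1 = moment 2 1 / ?F * (exp (- (u * R / 4)) * ?F)"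
    using integral_square_near_0_pos by simp
  also have "\<dots> \<le> moment 2 1 / ?F * truncated_moment2 u"
    using low integral_square_near_0_pos moment_nonneg[of 2 1] by (intro mult_left_mono) auto
  finally show ?thesis
    using split tail truncated_moment2_half_le[of u] u unfolding doubling_const_def distrib_right by linarith
qed

lemma truncated_moment2_le: "0 < u \<Longrightarrow> truncated_moment2 u \<le> moment 2 u"
  unfolding truncated_moment2_def moment_def
  by (rule integral_mono) (use integrable_truncated[of u "{0<..R}"] integrable_moment[of u 2] in \<open>auto simp: indicator_def\<close>)

lemma moment2_le:
  assumes "2 \<le> u"
  shows "moment 2 u \<le> doubling_const * truncated_moment2 (2 * u)"
  using moment2_half_le[of "2 * u"] assms by simp

text \<open>Half of the exponential weight absorbs one factor \<open>s\<close> at the cost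
  \<open>2 / u\<close>; the doubling bound then returns from \<open>u / 2\<close> to
  \<open>u\<close>.\<close>

lemma moment3_le:
  assumes u: "4 \<le> u"
  shows "moment 3 u \<le> 2 * doubling_const / u * moment 2 u"
proof -
  have "moment 3 u \<le> (\<integral>s. 2 / u * (s\<^sup>2 * exp (- (u / 2) * s)) \<partial>N)"
    unfolding moment_def
  proof (rule integral_mono_AE)
    show "AE s in N. s ^ 3 * exp (- u * s) \<le> 2 / u * (s\<^sup>2 * exp (- (u / 2) * s))"
      using AE_pos
    proof eventually_elim
      case (elim s)
      have "u * s / 2 \<le> exp (u * s / 2)"
        using exp_ge_add_one_self[of "u * s / 2"] by linarith
      then have "s * exp (- (u / 2) * s) \<le> 2 / u"
        using u by (simp add: exp_minus field_simps)
      then have "s * exp (- (u / 2) * s) * (s\<^sup>2 * exp (- (u / 2) * s)) \<le> 2 / u * (s\<^sup>2 * exp (- (u / 2) * s))"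
        by (rule mult_right_mono) simp
      moreover have "s * exp (- (u / 2) * s) * (s\<^sup>2 * exp (- (u / 2) * s)) = s ^ 3 * exp (- u * s)"
        by (simp add: power2_eq_square power3_eq_cube mult_ac flip: exp_add)
      ultimately show ?case by simp
    qed
  qed (use integrable_moment[of u 3] integrable_moment[of "u / 2" 2] u in auto)
  also have "\<dots> = 2 / u * moment 2 (u / 2)" by (simp add: moment_def)
  also have "\<dots> \<le> 2 / u * (doubling_const * moment 2 u)"
    using moment2_half_le[OF u] truncated_moment2_le[of u] doubling_const_pos u
    by (intro mult_left_mono) (auto intro: order_trans mult_left_mono)
  finally show ?thesis by simp
qed

section \<open>Lower bounds for the decay of the exponent\<close>

text \<open>This is the negative real part of \<open>centred_exponent\<close>, hence the rate of
  decay of the modulus of the tilted characteristic function.\<close>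

definition cos_exponent :: "real \<Rightarrow> real \<Rightarrow> real" where
  "cos_exponent \<xi> u = (\<integral>s. (1 - cos (\<xi> * s)) * exp (- u * s) \<partial>N)"

lemma integrable_one_minus_cos:
  assumes "0 \<le> u"
  shows "integrable N (\<lambda>s. (1 - cos (\<xi> * s)) * exp (- u * s))"
proof (rule integrable_le_min)
  fix s :: real assume s: "0 < s"
  have "\<bar>Re (1 - exp (- (- \<i> * \<xi> * s)))\<bar> \<le> (2 + norm (- \<i> * \<xi>)) * min 1 s"
    by (rule order_trans[OF abs_Re_le_cmod norm_one_minus_exp_le]) (use s in auto)
  then have "\<bar>1 - cos (\<xi> * s)\<bar> \<le> (2 + \<bar>\<xi>\<bar>) * min 1 s"
    by (simp add: Re_exp norm_mult)
  moreover have "exp (- u * s) \<le> 1" using assms s by simp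
  ultimately have "\<bar>1 - cos (\<xi> * s)\<bar> * exp (- u * s) \<le> (2 + \<bar>\<xi>\<bar>) * min 1 s * 1"
    by (intro mult_mono) (use s in auto)
  then show "norm ((1 - cos (\<xi> * s)) * exp (- u * s)) \<le> (2 + \<bar>\<xi>\<bar>) * min 1 s"
    by (simp add: abs_mult)
qed simp

lemma cos_exponent_nonneg: "0 \<le> cos_exponent \<xi> u"
  unfolding cos_exponent_def by (rule integral_nonneg_AE) auto

lemma integrable_truncated_min:
  assumes "0 < u"
  shows "integrable N (\<lambda>s. min 1 ((\<xi> * s)\<^sup>2) * exp (- u * s) * indicator {0<..R} s)"
proof (rule Bochner_Integration.integrable_bound)
  show "integrable N (\<lambda>s. \<xi>\<^sup>2 * (s\<^sup>2 * exp (- u * s)))"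
    using integrable_moment[of u 2] assms by simp
  show "AE s in N. norm (min 1 ((\<xi> * s)\<^sup>2) * exp (- u * s) * indicator {0<..R} s)
      \<le> norm (\<xi>\<^sup>2 * (s\<^sup>2 * exp (- u * s)))"
    by (rule AE_I2) (auto simp: indicator_def abs_mult power_mult_distrib min_def)
qed simp

text \<open>The truncated square is bounded by the average over \<open>l\<close> of
  \<open>1 - cos (\<xi> * s * l)\<close>. After exchanging integrals, each dilation costs at most
  \<open>2 / \<kappa>\<close>, and the range of \<open>l\<close> has length 1/2, so the total loss
  is \<open>1 / \<kappa>\<close>.\<close>

lemma cos_exponent_ge:
  assumes u: "0 < u"
  shows "\<kappa> / 240 * (\<integral>s. min 1 ((\<xi> * s)\<^sup>2) * exp (- u * s) * indicator {0<..R} s \<partial>N) \<le> cos_exponent \<xi> u"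
proof -
  interpret N: sigma_finite_measure N by (rule sigma_finite_N)
  interpret pair_sigma_finite N lborel ..
  let ?w = "\<lambda>s. ennreal (exp (- u * s)) * indicator {0<..R} s"
  let ?J = "\<integral>\<^sup>+s. ennreal (1 - cos (\<xi> * s)) * ?w s \<partial>N"
  let ?m = "\<lambda>s. min 1 ((\<xi> * s)\<^sup>2) * exp (- u * s) * indicator {0<..R} s"
  have rescaled: "(\<integral>\<^sup>+s. ennreal (1 - cos (\<xi> * s * l)) * ?w s \<partial>N) \<le> ennreal (2 / \<kappa>) * ?J"
    if l: "l \<in> {1/2..1}" for l
  proof -
    define g where "g s = ennreal ((1 - cos (\<xi> * s)) * exp (- u * s))" for s :: real
    have [measurable]: "g \<in> borel_measurable borel" unfolding g_def by measurable
    \<comment> \<open>Since \<open>l \<le> 1\<close>, enlarging the weight to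
      \<open>exp (- u * (l * s))\<close> makes the integrand a function of \<open>l * s\<close>
      alone.\<close>
    have "ennreal (1 - cos (\<xi> * s * l)) * ?w s \<le> g (l * s) * indicator {0<..R} s" for s
    proof (cases "s \<in> {0<..R}")
      case True
      have "l * (u * s) \<le> 1 * (u * s)" using True l u by (intro mult_right_mono) auto
      then have "(1 - cos (\<xi> * s * l)) * exp (- u * s) \<le> (1 - cos (\<xi> * s * l)) * exp (- u * (l * s))"
        by (intro mult_left_mono) (auto simp: mult_ac)
      then show ?thesis using True
        by (simp add: g_def mult_ac ennreal_leI flip: ennreal_mult)
    qed simp
    then have "(\<integral>\<^sup>+s. ennreal (1 - cos (\<xi> * s * l)) * ?w s \<partial>N) \<le> (\<integral>\<^sup>+s. g (l * s) * indicator {0<..R} s \<partial>N)"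
      by (rule nn_integral_mono)
    also have "\<dots> \<le> ennreal (2 / \<kappa>) * (\<integral>\<^sup>+s. g s * indicator {0<..R} s \<partial>N)"
      by (rule nn_integral_rescale_le) (use l in auto)
    also have "(\<integral>\<^sup>+s. g s * indicator {0<..R} s \<partial>N) = ?J"
      by (intro nn_integral_cong) (simp add: g_def ennreal_mult mult_ac)
    finally show ?thesis .
  qed
  have "ennreal (1 / 240) * (\<integral>\<^sup>+s. ennreal (?m s) \<partial>N) = (\<integral>\<^sup>+s. ennreal (1 / 240) * ennreal (?m s) \<partial>N)"
    by (rule nn_integral_cmult[symmetric]) simp
  also have "\<dots> = (\<integral>\<^sup>+s. ennreal (min 1 ((\<xi> * s)\<^sup>2) / 240) * ?w s \<partial>N)"
    by (intro nn_integral_cong) (auto simp: indicator_def mult_ac simp flip: ennreal_mult')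
  also have "\<dots> \<le> (\<integral>\<^sup>+s. (\<integral>\<^sup>+l. ennreal (1 - cos (\<xi> * s * l)) * indicator {1/2..1} l \<partial>lborel) * ?w s \<partial>N)"
    by (intro nn_integral_mono mult_right_mono averaged_one_minus_cos) auto
  also have "\<dots> = (\<integral>\<^sup>+s. (\<integral>\<^sup>+l. ennreal (1 - cos (\<xi> * s * l)) * indicator {1/2..1} l * ?w s \<partial>lborel) \<partial>N)"
    by (intro nn_integral_cong nn_integral_multc[symmetric]) measurable
  also have "\<dots> = (\<integral>\<^sup>+l. (\<integral>\<^sup>+s. ennreal (1 - cos (\<xi> * s * l)) * indicator {1/2..1} l * ?w s \<partial>N) \<partial>lborel)"
    by (rule Fubini'[symmetric]) measurable
  also have "\<dots> \<le> (\<integral>\<^sup>+l. ennreal (2 / \<kappa>) * ?J * indicator {1/2..1::real} l \<partial>lborel)"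
  proof (rule nn_integral_mono)
    fix l :: real
    show "(\<integral>\<^sup>+s. ennreal (1 - cos (\<xi> * s * l)) * indicator {1/2..1} l * ?w s \<partial>N)
        \<le> ennreal (2 / \<kappa>) * ?J * indicator {1/2..1} l"
      using rescaled[of l] by (cases "l \<in> {1/2..1}") simp_all
  qed
  also have "\<dots> = ennreal (2 / \<kappa>) * ?J * ennreal (1 / 2)"
    by (subst nn_integral_cmult_indicator) simp_all
  also have "\<dots> = ennreal (2 / \<kappa>) * ennreal (1 / 2) * ?J"
    by (simp only: mult_ac)
  also have "ennreal (2 / \<kappa>) * ennreal (1 / 2) = ennreal (1 / \<kappa>)"
    using \<kappa>_pos by (subst ennreal_mult[symmetric]) auto
  also have "?J \<le> (\<integral>\<^sup>+s. ennreal ((1 - cos (\<xi> * s)) * exp (- u * s)) \<partial>N)"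
    by (intro nn_integral_mono) (auto simp: indicator_def ennreal_mult)
  also have "\<dots> = ennreal (cos_exponent \<xi> u)"
    unfolding cos_exponent_def
    by (rule nn_integral_eq_integral) (use integrable_one_minus_cos[of u \<xi>] u in auto)
  also have "(\<integral>\<^sup>+s. ennreal (?m s) \<partial>N) = ennreal (\<integral>s. ?m s \<partial>N)"
    by (rule nn_integral_eq_integral) (use integrable_truncated_min[OF u] in auto)
  finally have "ennreal (1 / 240 * (\<integral>s. ?m s \<partial>N)) \<le> ennreal (1 / \<kappa> * cos_exponent \<xi> u)"
    using \<kappa>_pos cos_exponent_nonneg by (simp add: mult_left_mono ennreal_mult' del: times_divide_eq_left)
  then have "1 / 240 * (\<integral>s. ?m s \<partial>N) \<le> 1 / \<kappa> * cos_exponent \<xi> u"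
    using \<kappa>_pos cos_exponent_nonneg[of \<xi> u] by (subst (asm) ennreal_le_iff) auto
  then show ?thesis using \<kappa>_pos by (simp add: field_simps)
qed

text \<open>With \<eta> the minimum of \<open>\<bar>\<xi>\<bar>\<close> and \<open>u\<close>, one
  factor \<open>exp (- u * s)\<close> is at most \<open>exp (- (\<eta> * s))\<close> and turns
  \<open>(\<eta> * s)\<close> squared into a lower bound for the truncated square. What remains is a
  second moment at \<open>2 * u\<close>, which is comparable with the one at
  \<open>u\<close>.\<close>

lemma cos_exponent_ge_min:
  assumes u: "4 \<le> u"
  shows "\<kappa> / (240 * doubling_const) * ((min \<bar>\<xi>\<bar> u)\<^sup>2 * moment 2 u) \<le> cos_exponent \<xi> u"
proof -
  define \<eta> where "\<eta> = min \<bar>\<xi>\<bar> u"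
  have \<eta>: "0 \<le> \<eta>" "\<eta> \<le> \<bar>\<xi>\<bar>" "\<eta> \<le> u" using u by (auto simp: \<eta>_def)
  have "\<eta>\<^sup>2 * truncated_moment2 (2 * u) = (\<integral>s. \<eta>\<^sup>2 * (s\<^sup>2 * exp (- (2 * u) * s) * indicator {0<..R} s) \<partial>N)"
    by (simp add: truncated_moment2_def)
  also have "\<dots> \<le> (\<integral>s. min 1 ((\<xi> * s)\<^sup>2) * exp (- u * s) * indicator {0<..R} s \<partial>N)"
  proof (rule integral_mono)
    fix s :: real
    show "\<eta>\<^sup>2 * (s\<^sup>2 * exp (- (2 * u) * s) * indicator {0<..R} s) \<le> min 1 ((\<xi> * s)\<^sup>2) * exp (- u * s) * indicator {0<..R} s"
    proof (cases "s \<in> {0<..R}")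
      case True
      have "(\<eta> * s)\<^sup>2 * exp (- u * s) \<le> (\<eta> * s)\<^sup>2 * exp (- (\<eta> * s))"
        using \<eta> True by (intro mult_left_mono) (auto intro: mult_right_mono)
      also have "\<dots> \<le> min 1 ((\<eta> * s)\<^sup>2)"
        using \<eta> True by (intro square_times_exp_le_min) auto
      also have "\<dots> \<le> min 1 ((\<xi> * s)\<^sup>2)"
      proof -
        have "(\<eta> * s)\<^sup>2 \<le> (\<bar>\<xi>\<bar> * s)\<^sup>2"
          using \<eta> True by (intro power_mono mult_right_mono) auto
        then show ?thesis by (simp add: power_mult_distrib min_le_iff_disj)
      qed
      finally have "(\<eta> * s)\<^sup>2 * exp (- u * s) * exp (- u * s) \<le> min 1 ((\<xi> * s)\<^sup>2) * exp (- u * s)"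
        by (rule mult_right_mono) simp
      moreover have "(\<eta> * s)\<^sup>2 * exp (- u * s) * exp (- u * s) = \<eta>\<^sup>2 * (s\<^sup>2 * exp (- (2 * u) * s))"
        by (simp add: power_mult_distrib mult.assoc flip: exp_add)
      ultimately show ?thesis
        using True by (simp only: indicator_simps mult_1_right)
    qed simp
  next
    show "integrable N (\<lambda>s. \<eta>\<^sup>2 * (s\<^sup>2 * exp (- (2 * u) * s) * indicator {0<..R} s))"
      by (intro integrable_mult_right integrable_truncated) (use u in auto)
    show "integrable N (\<lambda>s. min 1 ((\<xi> * s)\<^sup>2) * exp (- u * s) * indicator {0<..R} s)"
      by (rule integrable_truncated_min) (use u in auto)
  qed
  finally have "\<kappa> / 240 * (\<eta>\<^sup>2 * truncated_moment2 (2 * u))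
      \<le> \<kappa> / 240 * (\<integral>s. min 1 ((\<xi> * s)\<^sup>2) * exp (- u * s) * indicator {0<..R} s \<partial>N)"
    by (rule mult_left_mono) (use \<kappa>_pos in simp)
  also have "\<dots> \<le> cos_exponent \<xi> u"
    by (rule cos_exponent_ge) (use u in simp)
  finally have "\<kappa> / 240 * (\<eta>\<^sup>2 * truncated_moment2 (2 * u)) \<le> cos_exponent \<xi> u" .
  moreover have "\<kappa> / (240 * doubling_const) * (\<eta>\<^sup>2 * moment 2 u) \<le> \<kappa> / (240 * doubling_const) * (\<eta>\<^sup>2 * (doubling_const * truncated_moment2 (2 * u)))"
    using moment2_le[of u] u \<kappa>_pos doubling_const_pos by (intro mult_left_mono) auto
  moreover have "\<kappa> / (240 * doubling_const) * (\<eta>\<^sup>2 * (doubling_const * truncated_moment2 (2 * u))) = \<kappa> / 240 * (\<eta>\<^sup>2 * truncated_moment2 (2 * u))"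
    using doubling_const_pos by simp
  ultimately show ?thesis unfolding \<eta>_def by linarith
qed

text \<open>For \<open>s\<close> between \<open>1 / \<bar>\<xi>\<bar>\<close> and
  \<open>1 / u\<close> the truncated square is 1, the weight is at least \<open>exp (- 1)\<close>
  and \<open>k s\<close> is at least \<open>m / s\<close>; integrating \<open>1 / s\<close> produces
  the logarithm.\<close>

lemma cos_exponent_ge_ln:
  assumes u: "0 < u" "1 / u \<le> R" and m: "0 \<le> m" "\<And>s. 0 < s \<Longrightarrow> s \<le> 1 / u \<Longrightarrow> m \<le> s * k s"
    and \<xi>: "u \<le> \<bar>\<xi>\<bar>"
  shows "\<kappa> * m * exp (- 1) / 240 * ln (\<bar>\<xi>\<bar> / u) \<le> cos_exponent \<xi> u"
proof -
  let ?a = "1 / \<bar>\<xi>\<bar>" and ?b = "1 / u"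
  let ?f = "\<lambda>s. min 1 ((\<xi> * s)\<^sup>2) * exp (- u * s) * indicator {0<..R} s"
  have ab: "0 < ?a" "?a \<le> ?b" using u \<xi> by (auto simp: field_simps)
  have ftc: "(\<integral>s. (1 / s) * indicator {?a..?b} s \<partial>lborel) = ln ?b - ln ?a"
    "integrable lborel (\<lambda>s. (1 / s) * indicator {?a..?b} s)"
  proof -
    have "0 < s" if "?a \<le> s" for s using ab(1) that by linarith
    then have "(ln has_real_derivative 1 / s) (at s)" "0 \<le> 1 / s" if "?a \<le> s" for s
      using that by (auto intro!: derivative_eq_intros simp: less_imp_le)
    then show "(\<integral>s. (1 / s) * indicator {?a..?b} s \<partial>lborel) = ln ?b - ln ?a"
      "integrable lborel (\<lambda>s. (1 / s) * indicator {?a..?b} s)"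
      using ab(2) by (intro integral_FTC_Icc_nonneg integrable_FTC_Icc_nonneg[where F = ln]; simp)+
  qed
  have "m * exp (- 1) * ln (\<bar>\<xi>\<bar> / u) = m * exp (- 1) * (ln ?b - ln ?a)"
    using u \<xi> by (simp add: ln_div)
  also have "\<dots> = (\<integral>s. m * exp (- 1) * ((1 / s) * indicator {?a..?b} s) \<partial>lborel)"
    by (simp only: integral_mult_right_zero ftc)
  also have "\<dots> \<le> (\<integral>s. k s * ?f s \<partial>lborel)"
  proof (rule integral_mono)
    fix s :: real
    show "m * exp (- 1) * ((1 / s) * indicator {?a..?b} s) \<le> k s * ?f s"
    proof (cases "s \<in> {?a..?b}")
      case True
      then have "?a \<le> s" "s \<le> ?b" by auto
      then have s: "0 < s" "s \<le> R" using ab u(2) by linarith+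
      have "1 \<le> \<bar>\<xi>\<bar> * s" "u * s \<le> 1"
        using True u \<xi> by (auto simp: field_simps)
      note s = s this
      have "1\<^sup>2 \<le> (\<bar>\<xi>\<bar> * s)\<^sup>2" using s by (intro power_mono) auto
      then have "min 1 ((\<xi> * s)\<^sup>2) = 1" by (simp add: power_mult_distrib)
      moreover have "m / s * exp (- 1) \<le> k s * exp (- u * s)"
        using s m(2)[of s] True m(1) by (intro mult_mono) (auto simp: field_simps k_nonneg)
      ultimately show ?thesis using s True by (simp add: field_simps)
    next
      case False
      then show ?thesis by (simp add: k_nonneg)
    qed
  next
    show "integrable lborel (\<lambda>s. m * exp (- 1) * ((1 / s) * indicator {?a..?b} s))"
      by (intro integrable_mult_right ftc)
    show "integrable lborel (\<lambda>s. k s * ?f s)"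
      using integrable_truncated_min[OF u(1)] by (subst (asm) integral_N) simp_all
  qed
  also have "\<dots> = (\<integral>s. ?f s \<partial>N)" by (subst integral_N) simp_all
  finally have "\<kappa> / 240 * (m * exp (- 1) * ln (\<bar>\<xi>\<bar> / u)) \<le> \<kappa> / 240 * (\<integral>s. ?f s \<partial>N)"
    using \<kappa>_pos by (intro mult_left_mono) auto
  then show ?thesis using cos_exponent_ge[OF u(1), of \<xi>] by simp
qed

text \<open>On \<open>(0, 1/u]\<close> the weight is at least \<open>exp (- 1)\<close> and
  \<open>s * k s\<close> at least \<open>m\<close>, so the moment dominates a multiple of the
  integral of \<open>s\<close>. This is what makes \<open>w\<close> large once \<open>t * m\<close>
  is.\<close>

lemma moment2_ge:
  assumes u: "0 < u" and m: "0 \<le> m" "\<And>s. 0 < s \<Longrightarrow> s \<le> 1 / u \<Longrightarrow> m \<le> s * k s"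
  shows "m * exp (- 1) / 2 \<le> u\<^sup>2 * moment 2 u"
proof -
  have ftc: "(\<integral>s. s * indicator {0..1/u} s \<partial>lborel) = (1/u)\<^sup>2 / 2 - 0\<^sup>2 / 2"
    "integrable lborel (\<lambda>s. s * indicator {0..1/u} s)"
  proof -
    have "((\<lambda>s. s\<^sup>2 / 2) has_real_derivative s) (at s)" for s
      by (auto intro!: derivative_eq_intros)
    then show "(\<integral>s. s * indicator {0..1/u} s \<partial>lborel) = (1/u)\<^sup>2 / 2 - 0\<^sup>2 / 2"
      "integrable lborel (\<lambda>s. s * indicator {0..1/u} s)"
      using u by (intro integral_FTC_Icc_nonneg[where F = "\<lambda>s. s\<^sup>2 / 2"] integrable_FTC_Icc_nonneg[where F = "\<lambda>s. s\<^sup>2 / 2"]; simp)+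
  qed
  have "m * exp (- 1) * ((1/u)\<^sup>2 / 2 - 0\<^sup>2 / 2) = (\<integral>s. m * exp (- 1) * (s * indicator {0..1/u} s) \<partial>lborel)"
    by (simp only: integral_mult_right_zero ftc)
  also have "\<dots> \<le> (\<integral>s. k s * (s\<^sup>2 * exp (- u * s)) \<partial>lborel)"
  proof (rule integral_mono)
    fix s :: real
    show "m * exp (- 1) * (s * indicator {0..1/u} s) \<le> k s * (s\<^sup>2 * exp (- u * s))"
    proof (cases "0 < s \<and> s \<le> 1 / u")
      case True
      then have "m * exp (- 1) \<le> (s * k s) * exp (- u * s)"
        using m u by (intro mult_mono) (auto simp: field_simps k_nonneg)
      then have "s * (m * exp (- 1)) \<le> s * ((s * k s) * exp (- u * s))"
        using True by (intro mult_left_mono) auto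
      then show ?thesis using True by (simp add: power2_eq_square mult_ac)
    qed (auto simp: indicator_def k_nonneg)
  next
    show "integrable lborel (\<lambda>s. m * exp (- 1) * (s * indicator {0..1/u} s))"
      by (intro integrable_mult_right ftc)
    show "integrable lborel (\<lambda>s. k s * (s\<^sup>2 * exp (- u * s)))"
      using integrable_moment[OF u, of 2] by (simp add: integral_N)
  qed
  also have "\<dots> = moment 2 u" unfolding moment_def by (subst integral_N) simp_all
  finally show ?thesis using u by (simp add: field_simps power2_eq_square)
qed

end

section \<open>Comparison with the Gaussian\<close>

text \<open>The cubic times \<open>1 + \<theta>^2\<close> is at most
  \<open>2 + 2 * \<bar>\<theta>\<bar> ^ 6\<close>, and the third order term of the exponential
  series bounds \<open>\<bar>\<theta>\<bar> ^ 6\<close> against the Gaussian by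
  \<open>6 / c ^ 3\<close>.\<close>

lemma gaussian_dominated:
  fixes c \<theta> :: real
  assumes c: "0 < c"
  shows "\<bar>\<theta>\<bar> ^ 3 * exp (- (c * \<theta>\<^sup>2)) \<le> (2 + 12 / c ^ 3) / (1 + \<theta>\<^sup>2)"
proof -
  let ?y = "\<bar>\<theta>\<bar>"
  have "(c * \<theta>\<^sup>2) ^ 3 / fact 3 \<le> exp (c * \<theta>\<^sup>2)"
    by (rule power_div_fact_le_exp) (use c in simp)
  then have "?y ^ 6 * exp (- (c * \<theta>\<^sup>2)) \<le> 6 / c ^ 3"
    using c by (simp add: exp_minus field_simps power_mult_distrib fact_numeral flip: power_mult)
  moreover have "exp (- (c * \<theta>\<^sup>2)) \<le> 1" using c by simp
  moreover have "?y ^ 3 * (1 + \<theta>\<^sup>2) \<le> 2 + 2 * ?y ^ 6"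
  proof -
    have "?y ^ n \<le> 1 + ?y ^ 6" if "n \<le> 6" for n
    proof (cases "?y \<le> 1")
      case True
      then have "?y ^ n \<le> 1" by (intro power_le_one) auto
      then show ?thesis by (simp add: add_increasing2)
    next
      case False
      then have "?y ^ n \<le> ?y ^ 6" using that by (intro power_increasing) auto
      then show ?thesis by simp
    qed
    from this[of 3] this[of 5] have "?y ^ 3 + ?y ^ 5 \<le> 2 + 2 * ?y ^ 6" by simp
    moreover have "?y ^ 3 * (1 + \<theta>\<^sup>2) = ?y ^ 3 + ?y ^ 5"
      using power_add[of ?y 3 2] by (simp add: distrib_left)
    ultimately show ?thesis by simp
  qed
  then have "?y ^ 3 * (1 + \<theta>\<^sup>2) * exp (- (c * \<theta>\<^sup>2)) \<le> (2 + 2 * ?y ^ 6) * exp (- (c * \<theta>\<^sup>2))"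
    by (rule mult_right_mono) simp
  moreover have "(2 + 2 * ?y ^ 6) * exp (- (c * \<theta>\<^sup>2)) = 2 * exp (- (c * \<theta>\<^sup>2)) + 2 * (?y ^ 6 * exp (- (c * \<theta>\<^sup>2)))"
    by (simp only: distrib_right mult.assoc)
  ultimately have "?y ^ 3 * (1 + \<theta>\<^sup>2) * exp (- (c * \<theta>\<^sup>2)) \<le> 2 + 12 / c ^ 3"
    by linarith
  moreover have "0 < 1 + \<theta>\<^sup>2" by (simp add: add_pos_nonneg)
  ultimately show ?thesis by (simp add: field_simps)
qed

lemma square_times_exp_le:
  fixes c y :: real
  assumes "0 < c" "0 \<le> y"
  shows "y\<^sup>2 * exp (- (c * y)) \<le> 2 / c\<^sup>2"
proof -
  have "(c * y) ^ 2 / fact 2 \<le> exp (c * y)"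
    by (rule power_div_fact_le_exp) (use assms in simp)
  then show ?thesis
    using assms by (simp add: exp_minus field_simps power_mult_distrib fact_numeral)
qed

text \<open>For small \<theta> the two exponents are close, and the mean value bound multiplies
  their distance by a Gaussian. For large \<theta> each exponential is small on its own: the
  logarithm in \<open>re_far\<close> supplies decay in \<theta>, the term in \<open>w\<close> a
  factor \<open>1 / sqrt w\<close>.\<close>

lemma exp_compare_gaussian:
  fixes a :: complex and c d w \<theta> :: real
  assumes c: "0 < c" "c \<le> 1/2" and w: "1 \<le> w" and d: "0 \<le> d"
    and near: "\<theta>\<^sup>2 \<le> w \<Longrightarrow> norm (a + of_real (\<theta>\<^sup>2 / 2)) \<le> d * \<bar>\<theta>\<bar> ^ 3 / sqrt w"
    and re_near: "\<theta>\<^sup>2 \<le> w \<Longrightarrow> Re a \<le> - (c * \<theta>\<^sup>2)"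
    and re_far: "w < \<theta>\<^sup>2 \<Longrightarrow> Re a \<le> - (c / 2 * w) - ln (\<theta>\<^sup>2 / w)"
  shows "norm (exp a - of_real (exp (- (\<theta>\<^sup>2 / 2))))
      \<le> (d * (2 + 12 / c ^ 3) + 16 / c\<^sup>2 + 16) / sqrt w * (1 / (1 + \<theta>\<^sup>2))"
proof (cases "\<theta>\<^sup>2 \<le> w")
  case True
  \<comment> \<open>The bound \<open>c \<le> 1/2\<close> makes the real parts of both exponents at
    most \<open>- (c * \<theta>^2)\<close>.\<close>
  have "norm (exp a - exp (- of_real (\<theta>\<^sup>2 / 2))) \<le> exp (- (c * \<theta>\<^sup>2)) * norm (a - - of_real (\<theta>\<^sup>2 / 2))"
    by (rule norm_exp_diff_le) (use re_near[OF True] c mult_right_mono[of c "1/2" "\<theta>\<^sup>2"] in auto)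
  also have "\<dots> \<le> exp (- (c * \<theta>\<^sup>2)) * (d * \<bar>\<theta>\<bar> ^ 3 / sqrt w)"
    using near[OF True] by (intro mult_left_mono) auto
  also have "\<dots> = d / sqrt w * (\<bar>\<theta>\<bar> ^ 3 * exp (- (c * \<theta>\<^sup>2)))" by simp
  also have "\<dots> \<le> d / sqrt w * ((2 + 12 / c ^ 3) / (1 + \<theta>\<^sup>2))"
    using d w by (intro mult_left_mono gaussian_dominated c) auto
  also have "\<dots> = d * (2 + 12 / c ^ 3) / sqrt w * (1 / (1 + \<theta>\<^sup>2))" by simp
  also have "\<dots> \<le> (d * (2 + 12 / c ^ 3) + 16 / c\<^sup>2 + 16) / sqrt w * (1 / (1 + \<theta>\<^sup>2))"
    using w by (intro mult_right_mono divide_right_mono) auto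
  finally show ?thesis by (simp flip: exp_of_real)
next
  case False
  then have \<theta>: "w < \<theta>\<^sup>2" "1 < \<theta>\<^sup>2" using w by auto
  have sqw: "sqrt w \<le> w" "0 < sqrt w" "sqrt w \<le> \<theta>\<^sup>2"
    using w \<theta> real_sqrt_le_mono[of w "w\<^sup>2"] by (auto simp: power2_eq_square intro: order_trans)
  have "2 / (2 * \<theta>\<^sup>2) \<le> 2 / (1 + \<theta>\<^sup>2)"
    using \<theta> by (intro divide_left_mono mult_pos_pos) auto
  then have third: "1 / \<theta>\<^sup>2 \<le> 2 * (1 / (1 + \<theta>\<^sup>2))" by simp
  have "norm (exp a) \<le> exp (- (c / 2 * w) - ln (\<theta>\<^sup>2 / w))"
    using re_far[OF \<theta>(1)] by simp
  also have "\<dots> = exp (- (c / 2 * w)) * (w / \<theta>\<^sup>2)"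
    using \<theta> w by (subst exp_diff, subst exp_ln) (auto intro!: divide_pos_pos)
  \<comment> \<open>The exponential absorbs \<open>w * sqrt w\<close>, which is at most
    \<open>w ^ 2\<close> because \<open>1 \<le> w\<close>; one factor \<open>1 / sqrt w\<close> is
    left over.\<close>
  also have "\<dots> \<le> (8 / c\<^sup>2) / sqrt w * (1 / \<theta>\<^sup>2)"
  proof -
    have "w * sqrt w * exp (- (c / 2 * w)) \<le> w\<^sup>2 * exp (- (c / 2 * w))"
      using sqw w by (intro mult_right_mono) (auto simp: power2_eq_square)
    also have "\<dots> \<le> 2 / (c / 2)\<^sup>2" by (rule square_times_exp_le) (use c w in auto)
    also have "\<dots> = 8 / c\<^sup>2" by (simp add: power_divide)
    finally have "w * exp (- (c / 2 * w)) \<le> (8 / c\<^sup>2) / sqrt w"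
      by (simp only: pos_le_divide_eq[OF sqw(2)] mult_ac)
    then have "w * exp (- (c / 2 * w)) * (1 / \<theta>\<^sup>2) \<le> (8 / c\<^sup>2) / sqrt w * (1 / \<theta>\<^sup>2)"
      by (rule mult_right_mono) simp
    then show ?thesis by (simp add: mult_ac)
  qed
  also have "\<dots> \<le> (8 / c\<^sup>2) / sqrt w * (2 * (1 / (1 + \<theta>\<^sup>2)))"
    using third c sqw by (intro mult_left_mono) auto
  also have "\<dots> = (16 / c\<^sup>2) / sqrt w * (1 / (1 + \<theta>\<^sup>2))" by simp
  finally have 1: "norm (exp a) \<le> (16 / c\<^sup>2) / sqrt w * (1 / (1 + \<theta>\<^sup>2))" .
  have "(\<theta>\<^sup>2)\<^sup>2 * exp (- (1/2 * \<theta>\<^sup>2)) \<le> 2 / (1/2)\<^sup>2"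
    by (rule square_times_exp_le) auto
  then have "(\<theta>\<^sup>2)\<^sup>2 * exp (- (\<theta>\<^sup>2 / 2)) \<le> 8" by (simp add: power2_eq_square)
  moreover have "sqrt w * (1 + \<theta>\<^sup>2) \<le> \<theta>\<^sup>2 * (2 * \<theta>\<^sup>2)"
    using sqw \<theta> by (intro mult_mono) auto
  then have "sqrt w * (1 + \<theta>\<^sup>2) * exp (- (\<theta>\<^sup>2 / 2)) \<le> \<theta>\<^sup>2 * (2 * \<theta>\<^sup>2) * exp (- (\<theta>\<^sup>2 / 2))"
    by (rule mult_right_mono) simp
  moreover have "\<theta>\<^sup>2 * (2 * \<theta>\<^sup>2) * exp (- (\<theta>\<^sup>2 / 2)) = 2 * ((\<theta>\<^sup>2)\<^sup>2 * exp (- (\<theta>\<^sup>2 / 2)))"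
    by (simp add: power2_eq_square)
  ultimately have "sqrt w * (1 + \<theta>\<^sup>2) * exp (- (\<theta>\<^sup>2 / 2)) \<le> 16"
    by linarith
  then have 2: "exp (- (\<theta>\<^sup>2 / 2)) \<le> 16 / sqrt w * (1 / (1 + \<theta>\<^sup>2))"
    using sqw by (simp add: field_simps add_pos_nonneg)
  have "norm (exp a - of_real (exp (- (\<theta>\<^sup>2 / 2)))) \<le> norm (exp a) + exp (- (\<theta>\<^sup>2 / 2))"
    by (rule order_trans[OF norm_triangle_ineq4]) simp
  also have "\<dots> \<le> (16 / c\<^sup>2) / sqrt w * (1 / (1 + \<theta>\<^sup>2)) + 16 / sqrt w * (1 / (1 + \<theta>\<^sup>2))"
    using 1 2 by (rule add_mono)
  also have "\<dots> = (16 / c\<^sup>2 + 16) / sqrt w * (1 / (1 + \<theta>\<^sup>2))"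
    by (simp add: add_divide_distrib)
  also have "\<dots> \<le> (d * (2 + 12 / c ^ 3) + 16 / c\<^sup>2 + 16) / sqrt w * (1 / (1 + \<theta>\<^sup>2))"
    using w d c by (intro mult_right_mono divide_right_mono) auto
  finally show ?thesis .
qed

lemma integrable_cauchy_kernel: "integrable lborel (\<lambda>\<theta> :: real. 1 / (1 + \<theta>\<^sup>2))"
  using integrable_inverse_1_plus_square by (simp add: set_integrable_def inverse_eq_divide)

lemma gaussian_integral:
  "integrable lborel (\<lambda>\<theta> :: real. exp (- (\<theta>\<^sup>2 / 2)))"
  "(\<integral>\<theta>. exp (- (\<theta>\<^sup>2 / 2)) \<partial>lborel) = sqrt (2 * pi)"
proof -
  have eq: "exp (- (\<theta>\<^sup>2 / 2)) = sqrt (2 * pi) * std_normal_density \<theta>" for \<theta> :: real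
    by (simp add: std_normal_density_def)
  show "integrable lborel (\<lambda>\<theta> :: real. exp (- (\<theta>\<^sup>2 / 2)))"
    "(\<integral>\<theta>. exp (- (\<theta>\<^sup>2 / 2)) \<partial>lborel) = sqrt (2 * pi)"
    unfolding eq by simp_all
qed

section \<open>Convergence of the tilted Fourier integral\<close>

context doubling_levy_density
begin

lemma Re_centred_exponent:
  assumes u: "0 < u"
  shows "Re (centred_exponent \<xi> u) = - cos_exponent \<xi> u"
proof -
  have "Re (centred_exponent \<xi> u) = (\<integral>s. Re ((iexp (\<xi> * s) - 1 - \<i> * of_real (\<xi> * s)) * of_real (exp (- u * s))) \<partial>N)"
    unfolding centred_exponent_eq(2)[OF u] by (rule integral_Re[OF centred_exponent_eq(1)[OF u], symmetric])
  also have "\<dots> = (\<integral>s. - ((1 - cos (\<xi> * s)) * exp (- u * s)) \<partial>N)"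
    by (intro Bochner_Integration.integral_cong) (auto simp: Re_exp algebra_simps)
  finally show ?thesis by (simp add: cos_exponent_def)
qed

text \<open>The constant of \<open>exp_compare_gaussian\<close> with
  \<open>d = doubling_const / 3\<close> and with \<open>c\<close> the constant of
  \<open>cos_exponent_ge_min\<close>, capped at 1/2.\<close>

definition error_const :: real where
  "error_const = (let c = min (\<kappa> / (240 * doubling_const)) (1/2) in doubling_const / 3 * (2 + 12 / c ^ 3) + 16 / c\<^sup>2 + 16)"

text \<open>With \<open>\<xi> = \<theta> / sqrt V\<close> the threshold
  \<open>\<theta>^2 \<le> w\<close> reads \<open>\<bar>\<xi>\<bar> \<le> u\<close>, so the Taylor
  estimate, the quadratic lower bound and the logarithmic lower bound supply the three inputs of the
  Gaussian comparison. The first condition on \<open>t * m\<close> gives \<open>1 \<le> w\<close>,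
  the second makes the logarithmic growth strong enough.\<close>

lemma exp_centred_exponent_bound:
  assumes u: "4 \<le> u" "1 / u \<le> R" and t: "0 < t"
    and m: "0 \<le> m" "\<And>s. 0 < s \<Longrightarrow> s \<le> 1 / u \<Longrightarrow> m \<le> s * k s"
    and tm: "2 * exp 1 \<le> t * m" "960 * exp 1 / \<kappa> \<le> t * m"
  defines "V \<equiv> t * moment 2 u"
  shows "norm (exp (of_real t * centred_exponent (\<theta> / sqrt V) u) - of_real (exp (- (\<theta>\<^sup>2 / 2))))
      \<le> error_const / (u * sqrt V) * (1 / (1 + \<theta>\<^sup>2))"
proof -
  define w where "w = u\<^sup>2 * V"
  define c where "c = min (\<kappa> / (240 * doubling_const)) (1/2)"
  define \<xi> where "\<xi> = \<theta> / sqrt V"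
  have c: "0 < c" "c \<le> 1/2" "c \<le> \<kappa> / (240 * doubling_const)" using \<kappa>_pos doubling_const_pos by (auto simp: c_def)
  have "t * m * exp (- 1) / 2 \<le> w"
    using mult_left_mono[OF moment2_ge[of u m], of t] u m t by (simp add: w_def V_def mult_ac)
  moreover have "1 \<le> t * m * exp (- 1) / 2"
    using tm(1) by (simp add: exp_minus field_simps)
  ultimately have w: "1 \<le> w" by linarith
  then have "0 < u\<^sup>2 * V" by (simp add: w_def)
  then have V: "0 < V" by (rule zero_less_mult_pos) (use u in simp)
  have sqw: "sqrt w = u * sqrt V" using u by (simp add: w_def real_sqrt_mult)
  have \<theta>: "\<theta> = \<xi> * sqrt V" and \<theta>2: "\<theta>\<^sup>2 = \<xi>\<^sup>2 * V" using V by (simp_all add: \<xi>_def power_mult_distrib power_divide)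
  have iff: "\<theta>\<^sup>2 \<le> w \<longleftrightarrow> \<bar>\<xi>\<bar> \<le> u"
    unfolding \<theta>2 w_def using V u by (simp add: abs_le_square_iff[symmetric])
  have Re: "Re (of_real t * centred_exponent \<xi> u) = - (t * cos_exponent \<xi> u)"
    using Re_centred_exponent[of u \<xi>] u by simp
  have "error_const = doubling_const / 3 * (2 + 12 / c ^ 3) + 16 / c\<^sup>2 + 16" by (simp add: error_const_def c_def Let_def)
  moreover have "norm (exp (of_real t * centred_exponent \<xi> u) - of_real (exp (- (\<theta>\<^sup>2 / 2))))
      \<le> (doubling_const / 3 * (2 + 12 / c ^ 3) + 16 / c\<^sup>2 + 16) / sqrt w * (1 / (1 + \<theta>\<^sup>2))"
  proof (rule exp_compare_gaussian[OF c(1,2) w])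
    show "0 \<le> doubling_const / 3" using doubling_const_pos by simp
    show "norm (of_real t * centred_exponent \<xi> u + of_real (\<theta>\<^sup>2 / 2)) \<le> doubling_const / 3 * \<bar>\<theta>\<bar> ^ 3 / sqrt w"
    proof -
      have "of_real t * centred_exponent \<xi> u + of_real (\<theta>\<^sup>2 / 2)
          = of_real t * (centred_exponent \<xi> u + of_real (\<xi>\<^sup>2 / 2 * moment 2 u))"
        by (simp add: \<theta>2 V_def algebra_simps)
      then have "norm (of_real t * centred_exponent \<xi> u + of_real (\<theta>\<^sup>2 / 2)) \<le> t * (\<bar>\<xi>\<bar> ^ 3 / 6 * moment 3 u)"
        using norm_centred_exponent_le[of u \<xi>] u t by (simp add: norm_mult mult_left_mono del: of_real_mult of_real_power of_real_divide)
      also have "\<dots> \<le> t * (\<bar>\<xi>\<bar> ^ 3 / 6 * (2 * doubling_const / u * moment 2 u))"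
        using moment3_le[OF u(1)] t by (intro mult_left_mono) auto
      also have "\<dots> = doubling_const / 3 * (\<bar>\<xi>\<bar> ^ 3 * V) / u" by (simp add: V_def)
      also have "\<bar>\<xi>\<bar> ^ 3 * V = \<bar>\<theta>\<bar> ^ 3 / sqrt V"
        using V by (simp add: \<theta> abs_mult power_mult_distrib power3_eq_cube field_simps)
      finally show ?thesis by (simp add: sqw mult_ac)
    qed
    have near: "c * min (\<theta>\<^sup>2) w \<le> t * cos_exponent \<xi> u"
    proof -
      have "min (\<theta>\<^sup>2) w = t * ((min \<bar>\<xi>\<bar> u)\<^sup>2 * moment 2 u)"
        using iff by (cases "\<bar>\<xi>\<bar> \<le> u") (simp_all add: \<theta>2 w_def V_def min_def)
      then have "c * min (\<theta>\<^sup>2) w \<le> t * (\<kappa> / (240 * doubling_const) * ((min \<bar>\<xi>\<bar> u)\<^sup>2 * moment 2 u))"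
        using c t moment_nonneg[of 2 u] mult_right_mono[OF c(3), of "min (\<theta>\<^sup>2) w"] by (simp add: mult_ac)
      also have "\<dots> \<le> t * cos_exponent \<xi> u"
        using cos_exponent_ge_min[OF u(1), of \<xi>] t by (intro mult_left_mono) auto
      finally show ?thesis .
    qed
    show "Re (of_real t * centred_exponent \<xi> u) \<le> - (c * \<theta>\<^sup>2)" if "\<theta>\<^sup>2 \<le> w"
      using near that unfolding Re by (simp add: min_def)
    show "Re (of_real t * centred_exponent \<xi> u) \<le> - (c / 2 * w) - ln (\<theta>\<^sup>2 / w)" if far: "w < \<theta>\<^sup>2"
    proof -
      have \<xi>: "u \<le> \<bar>\<xi>\<bar>" using far iff by linarith
      have "ln (\<theta>\<^sup>2 / w) = ln ((\<bar>\<xi>\<bar> / u)\<^sup>2)"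
        using V by (simp add: \<theta>2 w_def power_divide)
      also have "\<dots> = 2 * ln (\<bar>\<xi>\<bar> / u)"
        using u \<xi> by (subst ln_realpow) auto
      \<comment> \<open>The number 960 is chosen so that half of
        \<open>t * cos_exponent \<xi> u\<close> already pays for the logarithm; the other half is
        left for \<open>c / 2 * w\<close>.\<close>
      also have "\<dots> \<le> (\<kappa> * (t * m) * exp (- 1) / 480) * ln (\<bar>\<xi>\<bar> / u)"
      proof (rule mult_right_mono)
        show "2 \<le> \<kappa> * (t * m) * exp (- 1) / 480"
          using tm(2) \<kappa>_pos by (simp add: exp_minus field_simps)
        show "0 \<le> ln (\<bar>\<xi>\<bar> / u)" using u \<xi> by (intro ln_ge_zero) (simp add: field_simps)
      qed
      also have "\<dots> = 1/2 * (t * (\<kappa> * m * exp (- 1) / 240 * ln (\<bar>\<xi>\<bar> / u)))" by simp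
      also have "\<dots> \<le> 1/2 * (t * cos_exponent \<xi> u)"
        using cos_exponent_ge_ln[OF _ u(2) m \<xi>] u t by (intro mult_left_mono) auto
      finally have "ln (\<theta>\<^sup>2 / w) \<le> 1/2 * (t * cos_exponent \<xi> u)" .
      then show ?thesis unfolding Re using near far by (simp add: min_def)
    qed
  qed
  ultimately show ?thesis by (simp add: \<xi>_def sqw)
qed

text \<open>The substitution \<open>\<xi> = \<theta> / sqrt V\<close> and integration of the
  pointwise bound against \<open>1 / (1 + \<theta>^2)\<close> compare with the Gaussian integral;
  integrability of \<open>G\<close> follows because \<open>G\<close> rescaled is a Gaussian plus an
  integrable error. The last bound shows that the error vanishes as \<open>t * m\<close>
  grows.\<close>

lemma integral_exp_centred_exponent:
  assumes u: "4 \<le> u" "1 / u \<le> R" and t: "0 < t"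
    and m: "0 \<le> m" "\<And>s. 0 < s \<Longrightarrow> s \<le> 1 / u \<Longrightarrow> m \<le> s * k s"
    and tm: "2 * exp 1 \<le> t * m" "960 * exp 1 / \<kappa> \<le> t * m"
  defines "V \<equiv> t * moment 2 u" and "G \<equiv> \<lambda>\<xi>. exp (of_real t * centred_exponent \<xi> u)"
  shows "integrable lborel G"
    and "norm (of_real (sqrt V) * (\<integral>\<xi>. G \<xi> \<partial>lborel) - of_real (sqrt (2 * pi)))
      \<le> error_const / (u * sqrt V) * (\<integral>\<theta>. 1 / (1 + \<theta>\<^sup>2) \<partial>lborel)"
    and "t * m * exp (- 1) / 2 \<le> (u * sqrt V)\<^sup>2"
proof -
  have "t * m * exp (- 1) / 2 \<le> u\<^sup>2 * V"
    using mult_left_mono[OF moment2_ge[of u m], of t] u m t by (simp add: V_def mult_ac)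
  moreover have "1 \<le> t * m * exp (- 1) / 2"
    using tm(1) by (simp add: exp_minus field_simps)
  ultimately have "0 < u\<^sup>2 * V" by linarith
  then have V: "0 < V" by (rule zero_less_mult_pos) (use u in simp)
  show "t * m * exp (- 1) / 2 \<le> (u * sqrt V)\<^sup>2"
    using \<open>t * m * exp (- 1) / 2 \<le> u\<^sup>2 * V\<close> V by (simp add: power_mult_distrib)
  let ?gauss = "\<lambda>\<theta>. complex_of_real (exp (- (\<theta>\<^sup>2 / 2)))"
  define \<Delta> where "\<Delta> \<theta> = G (\<theta> / sqrt V) - ?gauss \<theta>" for \<theta>
  have G_meas [measurable]: "G \<in> borel_measurable borel"
    using measurable_centred_exponent[OF _ sigma_finite_N, of u] u unfolding G_def by simp
  have \<Delta>_bound: "norm (\<Delta> \<theta>) \<le> error_const / (u * sqrt V) * (1 / (1 + \<theta>\<^sup>2))" for \<theta>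
    using exp_centred_exponent_bound[OF u t m tm] unfolding \<Delta>_def G_def V_def by simp
  have kernel: "integrable lborel (\<lambda>\<theta>. error_const / (u * sqrt V) * (1 / (1 + \<theta>\<^sup>2)))"
    by (intro integrable_mult_right integrable_cauchy_kernel)
  have int_\<Delta>: "integrable lborel \<Delta>"
  proof (rule Bochner_Integration.integrable_bound[OF kernel])
    show "AE \<theta> in lborel. norm (\<Delta> \<theta>) \<le> norm (error_const / (u * sqrt V) * (1 / (1 + \<theta>\<^sup>2)))"
      unfolding real_norm_def by (intro AE_I2 order_trans[OF \<Delta>_bound abs_ge_self])
  qed (simp add: \<Delta>_def[abs_def])
  have int_gauss: "integrable lborel ?gauss"
    by (intro integrable_of_real gaussian_integral)
  have G_eq: "G (\<theta> / sqrt V) = \<Delta> \<theta> + ?gauss \<theta>" for \<theta> by (simp add: \<Delta>_def)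
  have "integrable lborel (\<lambda>\<theta>. G (\<theta> / sqrt V))"
    unfolding G_eq by (intro Bochner_Integration.integrable_add int_\<Delta> int_gauss)
  then show "integrable lborel G"
    using lborel_integrable_real_affine_iff[of "1 / sqrt V" G 0] V by simp
  have "of_real (sqrt V) * (\<integral>\<xi>. G \<xi> \<partial>lborel) = (\<integral>\<theta>. G (\<theta> / sqrt V) \<partial>lborel)"
    using lborel_integral_real_affine[of "1 / sqrt V" G 0] V by (simp add: scaleR_conv_of_real)
  also have "\<dots> = (\<integral>\<theta>. \<Delta> \<theta> \<partial>lborel) + of_real (sqrt (2 * pi))"
    unfolding G_eq Bochner_Integration.integral_add[OF int_\<Delta> int_gauss]
    by (simp only: integral_complex_of_real gaussian_integral)
  finally have "norm (of_real (sqrt V) * (\<integral>\<xi>. G \<xi> \<partial>lborel) - of_real (sqrt (2 * pi))) = norm (\<integral>\<theta>. \<Delta> \<theta> \<partial>lborel)"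
    by simp
  also have "\<dots> \<le> (\<integral>\<theta>. error_const / (u * sqrt V) * (1 / (1 + \<theta>\<^sup>2)) \<partial>lborel)"
    by (rule Bochner_Integration.integral_norm_bound_integral[OF int_\<Delta> kernel \<Delta>_bound])
  also have "\<dots> = error_const / (u * sqrt V) * (\<integral>\<theta>. 1 / (1 + \<theta>\<^sup>2) \<partial>lborel)"
    by (rule integral_mult_right_zero)
  finally show "norm (of_real (sqrt V) * (\<integral>\<xi>. G \<xi> \<partial>lborel) - of_real (sqrt (2 * pi)))
      \<le> error_const / (u * sqrt V) * (\<integral>\<theta>. 1 / (1 + \<theta>\<^sup>2) \<partial>lborel)" .
qed

text \<open>The strictly positive integral of the square over \<open>(0, R/4]\<close> is at most a
  constant times this moment, as the weight is bounded below there.\<close>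

lemma moment1_pos:
  assumes u: "0 < u"
  shows "0 < moment 1 u"
proof -
  let ?c = "R / 4 * exp (u * R / 4)"
  have "(\<integral>s. s\<^sup>2 * indicator {0<..R/4} s \<partial>N) \<le> (\<integral>s. ?c * (s ^ 1 * exp (- u * s)) \<partial>N)"
  proof (rule integral_mono_AE)
    show "AE s in N. s\<^sup>2 * indicator {0<..R/4} s \<le> ?c * (s ^ 1 * exp (- u * s))"
      using AE_pos
    proof eventually_elim
      case (elim s)
      show ?case
      proof (cases "s \<le> R / 4")
        case True
        have "u * s \<le> u * (R / 4)" using True u by (intro mult_left_mono) auto
        then have "1 \<le> exp (u * R / 4) * exp (- u * s)" by (simp flip: exp_add)
        then have "s * s * 1 \<le> R / 4 * s * (exp (u * R / 4) * exp (- u * s))"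
          using True elim by (intro mult_mono mult_right_mono) auto
        then show ?thesis using True elim by (simp add: power2_eq_square mult_ac)
      qed (use elim R_pos in simp)
    qed
  qed (use integrable_square_near_0 integrable_moment[OF u, of 1] in auto)
  also have "\<dots> = ?c * moment 1 u" by (simp add: moment_def)
  finally have "0 < ?c * moment 1 u"
    using integral_square_near_0_pos by linarith
  then show ?thesis by (rule zero_less_mult_pos) (use R_pos in simp)
qed

section \<open>The normalized density at the saddle point\<close>

text \<open>Uniformity lies in the order of quantifiers: \<open>A\<close> depends only on
  \<open>e\<close> and on constants of the locale. The condition \<open>x < t * moment 1 u\<close>
  forces \<sigma> to be at least \<open>u\<close>, so the hypotheses made at \<open>u\<close>
  persist at \<sigma>.\<close>

lemma normalized_density_close:
  fixes \<phi> :: "real \<Rightarrow> real" and p :: "real \<Rightarrow> real \<Rightarrow> real" and S :: "real \<Rightarrow> 'a \<Rightarrow> real"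
  assumes \<phi>: "\<And>u. \<phi> u = (\<integral>s. 1 - exp (- u * s) \<partial>N)"
    and P: "prob_space P"
    and T: "0 \<le> T"
    and p: "\<And>t. T < t \<Longrightarrow> bounded_continuous_density P (S t) (p t)"
    and lap: "\<And>t v. T < t \<Longrightarrow> 0 < v \<Longrightarrow> (\<integral>\<omega>. exp (- v * S t \<omega>) \<partial>P) = exp (- t * \<phi> v)"
    and e: "0 < e"
  shows "\<exists>A>0. \<forall>u m t x. 4 \<le> u \<longrightarrow> 1 / u \<le> R \<longrightarrow> 0 \<le> m \<longrightarrow> (\<forall>s. 0 < s \<longrightarrow> s \<le> 1 / u \<longrightarrow> m \<le> s * k s) \<longrightarrow>
      T < t \<longrightarrow> A \<le> t * m \<longrightarrow> 0 < x \<longrightarrow> x < t * moment 1 u \<longrightarrow>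
      dist (normalized_density p \<phi> t x) ((2 * pi) powr (- 1 / 2)) < e"
proof -
  define C where "C = \<bar>error_const * (\<integral>\<theta>. 1 / (1 + \<theta>\<^sup>2) \<partial>lborel)\<bar> / (2 * pi)"
  \<comment> \<open>The first two entries are the thresholds of the Gaussian comparison; the third
    makes \<open>u * sqrt V\<close> at least \<open>(C + 1) / e\<close>.\<close>
  define A where "A = max (max (2 * exp 1) (960 * exp 1 / \<kappa>)) (2 * exp 1 * ((C + 1) / e)\<^sup>2)"
  have A: "0 < A" "2 * exp 1 \<le> A" "960 * exp 1 / \<kappa> \<le> A" "2 * exp 1 * ((C + 1) / e)\<^sup>2 \<le> A"
    by (auto simp: A_def less_max_iff_disj)
  have deriv1: "(\<phi> has_real_derivative moment 1 u) (at u)" if "0 < u" for u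
    using has_derivative_laplace[OF that] by (simp add: \<phi>[abs_def])
  then have deriv_\<phi>: "deriv \<phi> u = moment 1 u" if "0 < u" for u
    using that by (intro DERIV_imp_deriv)
  have deriv2: "deriv (deriv \<phi>) u = - moment 2 u" if "0 < u" for u
  proof -
    have "\<forall>\<^sub>F v in nhds u. deriv \<phi> v = moment 1 v"
      using eventually_nhds_in_open[of "{0<..}" u] that by (auto elim!: eventually_mono simp: deriv_\<phi>)
    then have "deriv (deriv \<phi>) u = deriv (moment 1) u" by (rule deriv_cong_ev) simp
    also have "\<dots> = - moment 2 u"
      using has_derivative_moment[of u 1] that by (intro DERIV_imp_deriv) (simp add: numeral_2_eq_2)
    finally show ?thesis .
  qed
  have "dist (normalized_density p \<phi> t x) ((2 * pi) powr (- 1 / 2)) < e"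
    if u\<^sub>0: "4 \<le> u\<^sub>0" "1 / u\<^sub>0 \<le> R" and m: "0 \<le> m" "\<forall>s. 0 < s \<longrightarrow> s \<le> 1 / u\<^sub>0 \<longrightarrow> m \<le> s * k s"
      and t: "T < t" and tm: "A \<le> t * m" and x: "0 < x" "x < t * moment 1 u\<^sub>0" for u\<^sub>0 m t x
  proof -
    have t0: "0 < t" using T t by simp
    define u where "u = sigma_fun \<phi> t x"
    have "\<exists>v>0. moment 1 v = x / t"
      by (rule ex_moment1_eq[of u\<^sub>0]) (use u\<^sub>0 x t0 in \<open>auto simp: field_simps\<close>)
    then obtain v where "0 < v" "moment 1 v = x / t" by blast
    then have image: "x / t \<in> deriv \<phi> ` {0<..}"
      by (intro image_eqI[of _ _ v]) (simp_all add: deriv_\<phi>)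
    have u_pos: "0 < u" using inv_into_into[OF image] by (simp add: u_def sigma_fun_def)
    have "deriv \<phi> u = x / t" using f_inv_into_f[OF image] by (simp add: u_def sigma_fun_def)
    then have x_eq: "x = t * moment 1 u" using u_pos t0 by (simp add: deriv_\<phi>)
    \<comment> \<open>The first moment is decreasing: a smaller \<sigma> would make its value, which
      is \<open>x / t\<close>, at least the one at \<open>u\<^sub>0\<close>.\<close>
    have u_ge: "u\<^sub>0 \<le> u"
    proof (rule ccontr)
      assume "\<not> u\<^sub>0 \<le> u"
      then have "moment 1 u\<^sub>0 \<le> moment 1 u" using u_pos by (intro moment1_antimono) auto
      then have "t * moment 1 u\<^sub>0 \<le> t * moment 1 u" using t0 by (intro mult_left_mono) auto
      then show False using x(2) x_eq by simp
    qed
    have inv: "1 / u \<le> 1 / u\<^sub>0" using u_ge u\<^sub>0 by (intro divide_left_mono) auto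
    have u: "4 \<le> u" "1 / u \<le> R" using u_ge u\<^sub>0 inv by auto
    have mu: "m \<le> s * k s" if "0 < s" "s \<le> 1 / u" for s using m(2) that inv by auto
    define V where "V = t * moment 2 u"
    define G where "G = (\<lambda>\<xi>. exp (of_real t * centred_exponent \<xi> u))"
    note bounds = integral_exp_centred_exponent[OF u t0 m(1) mu order_trans[OF A(2) tm] order_trans[OF A(3) tm],
        folded V_def, folded G_def]
    have dens: "bounded_continuous_density P (S t) (p t)" by (rule p[OF t])
    have "complex_of_real (p t x * exp (t * (\<integral>s. 1 - exp (- u * s) \<partial>N) - u * x))
        = 1 / (2 * pi) * (\<integral>\<xi>. G \<xi> \<partial>lborel)"
      unfolding G_def
    proof (rule density_by_inversion[OF P _ _ _ _ u_pos x_eq x(1)])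
      show "integrable lborel (\<lambda>\<xi>. exp (of_real t * centred_exponent \<xi> u))"
        using bounds(1) by (simp add: G_def)
      show "distributed P lborel (S t) (\<lambda>y. ennreal (indicator {0<..} y * p t y))"
        using dens by (simp add: bounded_continuous_density_def)
    qed (use dens lap[OF t] \<phi> in \<open>auto simp: bounded_continuous_density_def\<close>)
    moreover have "normalized_density p \<phi> t x = sqrt V * (p t x * exp (t * (\<integral>s. 1 - exp (- u * s) \<partial>N) - u * x))"
    proof -
      have "t * H_fun \<phi> u = t * \<phi> u - u * x"
        by (simp add: H_fun_def deriv_\<phi>[OF u_pos] x_eq algebra_simps)
      moreover have "t * - deriv (deriv \<phi>) u = V"
        by (simp add: deriv2[OF u_pos] V_def)
      ultimately show ?thesis
        unfolding normalized_density_def Let_def u_def[symmetric] \<phi>[of u, symmetric] by simp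
    qed
    ultimately have "complex_of_real (normalized_density p \<phi> t x) = of_real (sqrt V) * (\<integral>\<xi>. G \<xi> \<partial>lborel) / (2 * pi)"
      by simp
    moreover have "(2 * pi) powr (- 1 / 2) = sqrt (2 * pi) / (2 * pi)"
      using powr_minus[of "2 * pi" "1 / 2"] powr_half_sqrt[of "2 * pi"] sqrt_divide_self_eq[of "2 * pi"]
      by simp
    ultimately have diff: "complex_of_real (normalized_density p \<phi> t x - (2 * pi) powr (- 1 / 2))
        = (of_real (sqrt V) * (\<integral>\<xi>. G \<xi> \<partial>lborel) - of_real (sqrt (2 * pi))) / of_real (2 * pi)"
      by (simp add: diff_divide_distrib)
    have "dist (normalized_density p \<phi> t x) ((2 * pi) powr (- 1 / 2))
        = norm (complex_of_real (normalized_density p \<phi> t x - (2 * pi) powr (- 1 / 2)))"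
      by (simp only: dist_norm norm_of_real real_norm_def)
    also have "\<dots> = norm (of_real (sqrt V) * (\<integral>\<xi>. G \<xi> \<partial>lborel) - of_real (sqrt (2 * pi))) / (2 * pi)"
      unfolding diff by (simp add: norm_divide norm_mult)
    also have "\<dots> \<le> error_const / (u * sqrt V) * (\<integral>\<theta>. 1 / (1 + \<theta>\<^sup>2) \<partial>lborel) / (2 * pi)"
      by (rule divide_right_mono[OF bounds(2)]) simp_all
    also have "\<dots> \<le> C / (u * sqrt V)"
    proof -
      have "error_const / (u * sqrt V) * (\<integral>\<theta>. 1 / (1 + \<theta>\<^sup>2) \<partial>lborel) / (2 * pi)
          = error_const * (\<integral>\<theta>. 1 / (1 + \<theta>\<^sup>2) \<partial>lborel) / (2 * pi) / (u * sqrt V)" by simp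
      also have "\<dots> \<le> C / (u * sqrt V)"
        unfolding C_def using u t0 moment_nonneg[of 2 u] by (intro divide_right_mono) (auto simp: V_def)
      finally show ?thesis .
    qed
    also have "C / (u * sqrt V) < e"
    proof -
      have "2 * exp 1 * ((C + 1) / e)\<^sup>2 \<le> t * m" using A(4) tm by linarith
      then have "((C + 1) / e)\<^sup>2 \<le> t * m * exp (- 1) / 2"
        by (simp add: exp_minus field_simps)
      also have "\<dots> \<le> (u * sqrt V)\<^sup>2" by (rule bounds(3)) simp_all
      \<comment> \<open>Using \<open>C + 1\<close> in place of \<open>C\<close> keeps the final
        inequality strict and \<open>u * sqrt V\<close> positive even when \<open>C\<close> is
        0.\<close>
      finally have "(C + 1) / e \<le> u * sqrt V"
        by (rule power2_le_imp_le) (use u t0 moment_nonneg[of 2 u] in \<open>auto simp: V_def\<close>)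
      moreover have "0 < (C + 1) / e" using e by (simp add: C_def add_nonneg_pos)
      ultimately have pos: "0 < u * sqrt V" and "C + 1 \<le> u * sqrt V * e"
        using pos_divide_le_eq[OF e, of "C + 1"] by (auto intro: less_le_trans)
      then have "C < e * (u * sqrt V)" by (simp add: mult_ac)
      then show ?thesis by (simp only: pos_divide_less_eq[OF pos])
    qed
    finally show ?thesis .
  qed
  with A(1) show ?thesis by blast
qed

end

section \<open>The two regimes: large time, and small space\<close>

theorem corollary3p3:
  fixes M :: "'a measure"
    and S :: "real \<Rightarrow> 'a \<Rightarrow> real"
    and \<nu> :: "real \<Rightarrow> real"
    and p :: "real \<Rightarrow> real \<Rightarrow> real"
    and T\<^sub>0 a\<^sub>8 a\<^sub>9 R\<^sub>3 :: real
  assumes S: "driftless_subordinator_with_density M S \<nu>"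
    and T0_nonneg: "0 \<le> T\<^sub>0"
    and T0_liminf: "Liminf (at_right 0) (\<lambda>x. ereal (x * \<nu> x)) = 1 / ereal T\<^sub>0"
    and p: "\<And>t. T\<^sub>0 < t \<Longrightarrow> bounded_continuous_density M (S t) (p t)"
    and const_pos: "0 < a\<^sub>8" "0 < a\<^sub>9" "0 < R\<^sub>3"
    and nu_pos: "\<And>r. 0 < r \<Longrightarrow> r < R\<^sub>3 \<Longrightarrow> 0 < \<nu> r"
    and nu_quotient: "\<And>r R. 0 < r \<Longrightarrow> r \<le> R \<Longrightarrow> R < R\<^sub>3 \<Longrightarrow>
           \<nu> r / \<nu> R \<ge> a\<^sub>8 * (R / r) powr (- a\<^sub>9)"
  shows "(\<forall>N>0. uniform_limit {0<..N}
             (\<lambda>t x. normalized_density p (laplace_exponent \<nu>) t x)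
             (\<lambda>x. (2 * pi) powr (- 1 / 2)) at_top) \<and>
         (T\<^sub>0 = 0 \<longrightarrow>
           (\<forall>N>0. uniform_limit {N..}
             (\<lambda>x t. normalized_density p (laplace_exponent \<nu>) t x)
             (\<lambda>t. (2 * pi) powr (- 1 / 2)) (at_right 0)))"
proof -
  define k where "k s = indicator {0<..} s * \<nu> s" for s :: real
  \<comment> \<open>The power bound at the extreme ratio 2, the worst case among dilations by
    factors between 1/2 and 1.\<close>
  define \<kappa> where "\<kappa> = a\<^sub>8 * 2 powr (- a\<^sub>9)"
  \<comment> \<open>Halving turns the open range below \<open>R\<^sub>3\<close> into a closed one on
    which the hypotheses still hold.\<close>
  define R where "R = R\<^sub>3 / 2"
  have levy: "levy_density \<nu>" and lap: "\<And>t u. 0 \<le> t \<Longrightarrow> 0 \<le> u \<Longrightarrow>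
      (\<integral>\<omega>. exp (- u * S t \<omega>) \<partial>M) = exp (- t * laplace_exponent \<nu> u)"
    and sub: "subordinator M S"
    using S by (auto simp: driftless_subordinator_with_density_def)
  have P: "prob_space M"
    using sub by (simp add: subordinator_def levy_process_def)
  interpret L: doubling_levy_density k \<kappa> R
  proof
    show "k \<in> borel_measurable borel"
      using levy by (simp add: levy_density_def set_borel_measurable_def k_def[abs_def])
    show "0 \<le> k s" for s
      using levy by (simp add: levy_density_def k_def indicator_def)
    show "integrable lborel (\<lambda>s. min 1 s * k s)"
      using levy by (simp add: levy_density_def set_integrable_def k_def mult_ac)
    show "0 < \<kappa>" "0 < R" using const_pos by (auto simp: \<kappa>_def R_def)
    show "k s = 0" if "s \<le> 0" for s using that by (simp add: k_def)
    show "0 < k s" if "0 < s" "s \<le> R" for s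
      using nu_pos[of s] that const_pos by (simp add: k_def R_def)
    show "\<kappa> * k s \<le> k (l * s)" if s: "0 < s" "s \<le> R" and l: "1/2 \<le> l" "l \<le> 1" for s l
    proof -
      have ls: "0 < l * s" "l * s \<le> s" using s l by (auto simp: mult_le_cancel_right1)
      have sR: "s < R\<^sub>3" using s const_pos by (simp add: R_def)
      have "2 powr (- a\<^sub>9) \<le> (s / (l * s)) powr (- a\<^sub>9)"
        using s l const_pos by (intro powr_mono2') (auto simp: field_simps)
      then have "\<kappa> \<le> a\<^sub>8 * (s / (l * s)) powr (- a\<^sub>9)"
        using const_pos by (simp add: \<kappa>_def)
      also have "\<dots> \<le> \<nu> (l * s) / \<nu> s" by (rule nu_quotient[OF ls sR])
      finally have "\<kappa> * \<nu> s \<le> \<nu> (l * s)"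
        using nu_pos[OF s(1) sR] by (simp add: field_simps)
      then show ?thesis using s ls by (simp add: k_def)
    qed
  qed
  have exponent: "laplace_exponent \<nu> u = (\<integral>s. 1 - exp (- u * s) \<partial>L.N)" for u
    by (subst L.integral_N) (auto simp: laplace_exponent_def set_lebesgue_integral_def k_def mult_ac intro!: Bochner_Integration.integral_cong)
  have inverse_T0: "1 / ereal T\<^sub>0 = (if T\<^sub>0 = 0 then \<infinity> else ereal (1 / T\<^sub>0))"
    by (simp add: divide_ereal_def inverse_eq_divide)
  \<comment> \<open>Any real \<open>m\<close> strictly below the lower limit is a lower bound for
    \<open>s * k s\<close> near 0; taking \<open>u\<close> large places \<open>(0, 1/u]\<close> in
    that neighbourhood.\<close>
  have near_0: "\<exists>u\<ge>4. 1 / u \<le> R \<and> (\<forall>s. 0 < s \<longrightarrow> s \<le> 1 / u \<longrightarrow> m \<le> s * k s)"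
    if "ereal m < 1 / ereal T\<^sub>0" for m
  proof -
    have "\<forall>\<^sub>F s in at_right 0. ereal m < ereal (s * \<nu> s)"
      using that unfolding T0_liminf[symmetric] by (rule less_LiminfD)
    then obtain d where d: "0 < d" "\<And>s. 0 < s \<Longrightarrow> s < d \<Longrightarrow> m < s * \<nu> s"
      by (auto simp: eventually_at_right_field)
    define u where "u = max 4 (max (1 / R) (2 / d))"
    have u: "4 \<le> u" "1 / R \<le> u" "2 / d \<le> u" by (auto simp: u_def)
    have "1 / u \<le> R" using u L.R_pos by (simp add: field_simps)
    moreover have "1 / u < d" using u d(1) by (simp add: field_simps)
    ultimately show ?thesis using u(1) d(2) by (intro exI[of _ u]) (auto simp: k_def less_imp_le)
  qed
  have close: "\<exists>A>0. \<forall>u m t x. 4 \<le> u \<longrightarrow> 1 / u \<le> R \<longrightarrow> 0 \<le> m \<longrightarrow> (\<forall>s. 0 < s \<longrightarrow> s \<le> 1 / u \<longrightarrow> m \<le> s * k s) \<longrightarrow>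
      T\<^sub>0 < t \<longrightarrow> A \<le> t * m \<longrightarrow> 0 < x \<longrightarrow> x < t * L.moment 1 u \<longrightarrow>
      dist (normalized_density p (laplace_exponent \<nu>) t x) ((2 * pi) powr (- 1 / 2)) < e" if "0 < e" for e
    by (rule L.normalized_density_close[OF exponent P T0_nonneg p _ that])
      (use lap T0_nonneg in auto)
  show ?thesis
  proof (intro conjI impI allI)
    fix N :: real assume N: "0 < N"
    show "uniform_limit {0<..N} (\<lambda>t x. normalized_density p (laplace_exponent \<nu>) t x)
       (\<lambda>x. (2 * pi) powr (- 1 / 2)) at_top"
    proof (rule uniform_limitI)
      fix e :: real assume "0 < e"
      then obtain A where A: "0 < A" and close_A: "\<And>u m t x. 4 \<le> u \<Longrightarrow> 1 / u \<le> R \<Longrightarrow> 0 \<le> m \<Longrightarrow>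
          (\<forall>s. 0 < s \<longrightarrow> s \<le> 1 / u \<longrightarrow> m \<le> s * k s) \<Longrightarrow> T\<^sub>0 < t \<Longrightarrow> A \<le> t * m \<Longrightarrow> 0 < x \<Longrightarrow> x < t * L.moment 1 u \<Longrightarrow>
          dist (normalized_density p (laplace_exponent \<nu>) t x) ((2 * pi) powr (- 1 / 2)) < e"
        using close by metis
      \<comment> \<open>Adding 1 keeps \<open>m\<close> strictly below \<open>1 / T\<^sub>0\<close>
        and covers \<open>T\<^sub>0 = 0\<close> as well. With \<open>m\<close> and \<open>u\<close>
        fixed, large \<open>t\<close> achieves both \<open>A \<le> t * m\<close> and
        \<open>N < t * L.moment 1 u\<close>.\<close>
      define m where "m = 1 / (T\<^sub>0 + 1)"
      have m: "0 < m" using T0_nonneg by (simp add: m_def)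
      have "ereal m < 1 / ereal T\<^sub>0"
        using T0_nonneg by (auto simp: inverse_T0 m_def field_simps)
      then obtain u where u: "4 \<le> u" "1 / u \<le> R" "\<forall>s. 0 < s \<longrightarrow> s \<le> 1 / u \<longrightarrow> m \<le> s * k s"
        using near_0 by metis
      have mom: "0 < L.moment 1 u" using u by (intro L.moment1_pos) simp
      show "\<forall>\<^sub>F t in at_top. \<forall>x\<in>{0<..N}. dist (normalized_density p (laplace_exponent \<nu>) t x) ((2 * pi) powr (- 1 / 2)) < e"
        using eventually_gt_at_top[of T\<^sub>0] eventually_ge_at_top[of "A / m"] eventually_gt_at_top[of "N / L.moment 1 u"]
      proof (eventually_elim, intro ballI)
        fix t x assume t: "T\<^sub>0 < t" "A / m \<le> t" "N / L.moment 1 u < t" and x: "x \<in> {0<..N}"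
        show "dist (normalized_density p (laplace_exponent \<nu>) t x) ((2 * pi) powr (- 1 / 2)) < e"
          by (rule close_A[of u m]) (use u m mom t x in \<open>auto simp: field_simps\<close>)
      qed
    qed
  next
    fix N :: real assume T0: "T\<^sub>0 = 0" and N: "0 < N"
    show "uniform_limit {N..} (\<lambda>x t. normalized_density p (laplace_exponent \<nu>) t x)
       (\<lambda>t. (2 * pi) powr (- 1 / 2)) (at_right 0)"
    proof (rule uniform_limitI)
      fix e :: real assume "0 < e"
      then obtain A where A: "0 < A" and close_A: "\<And>u m t x. 4 \<le> u \<Longrightarrow> 1 / u \<le> R \<Longrightarrow> 0 \<le> m \<Longrightarrow>
          (\<forall>s. 0 < s \<longrightarrow> s \<le> 1 / u \<longrightarrow> m \<le> s * k s) \<Longrightarrow> T\<^sub>0 < t \<Longrightarrow> A \<le> t * m \<Longrightarrow> 0 < x \<Longrightarrow> x < t * L.moment 1 u \<Longrightarrow>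
          dist (normalized_density p (laplace_exponent \<nu>) t x) ((2 * pi) powr (- 1 / 2)) < e"
        using close by metis
      \<comment> \<open>The lower limit is infinite here, so \<open>m = A / N\<close> is admissible
        and \<open>A \<le> t * m\<close> holds for all \<open>t \<ge> N\<close> at once; smallness
        of \<open>x\<close> then secures \<open>x < t * L.moment 1 u\<close>.\<close>
      have "ereal (A / N) < 1 / ereal T\<^sub>0" unfolding inverse_T0 by (simp add: T0)
      then obtain u where u: "4 \<le> u" "1 / u \<le> R" "\<forall>s. 0 < s \<longrightarrow> s \<le> 1 / u \<longrightarrow> A / N \<le> s * k s"
        using near_0 by metis
      have mom: "0 < L.moment 1 u" using u by (intro L.moment1_pos) simp
      have "\<forall>\<^sub>F x in at_right 0. 0 < x \<and> x < N * L.moment 1 u"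
        unfolding eventually_at_right_field using N mom by (intro exI[of _ "N * L.moment 1 u"]) auto
      then show "\<forall>\<^sub>F x in at_right 0. \<forall>t\<in>{N..}. dist (normalized_density p (laplace_exponent \<nu>) t x) ((2 * pi) powr (- 1 / 2)) < e"
      proof (eventually_elim, intro ballI)
        fix x t assume x: "0 < x \<and> x < N * L.moment 1 u" and t: "t \<in> {N..}"
        have "A \<le> t * (A / N)" using t N A by (simp add: field_simps)
        moreover have "N * L.moment 1 u \<le> t * L.moment 1 u" using t mom by (intro mult_right_mono) auto
        ultimately show "dist (normalized_density p (laplace_exponent \<nu>) t x) ((2 * pi) powr (- 1 / 2)) < e"
          by (intro close_A[of u "A / N"]) (use u A N t x T0 in auto)
      qed
    qed
  qed
qed

end
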